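(* Let $L, K, c, \gamma$ be positive real numbers. Let $G$ be a graph on $n$ vertices with a $K,c$ component tail and $S(G) \leq L$. Add $(1-\gamma)\frac{n}{2L}$ independent uniformly random edges to $G$ (ignoring repeated edges), and let the result be $G'$. Then there exist constants $K', c'$ (depending only on $L,K,c,\gamma$) such that with high probability $G'$ has a $K',c'$ component tail and $S(G') \leq \frac{L}{\gamma} + o(1)$.
   Context: For a graph $G$ on $n$ vertices, the susceptibility is $S(G) = \frac{1}{n}\sum_v C_v$, where $C_v$ is the order of the connected component containing $v$ (equivalently, $\frac1n$ times the sum of squares of component orders). A graph has a $K,c$ component tail if for all positive integers $s$, at most a $Ke^{-cs}$-fraction of its vertices lie in components of order at least $s$. Each random edge is chosen uniformly among all pairs of distinct vertices, independently. "With high probability" means with probability tending to $1$ as $n\to\infty$. *)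

theory Defs
  imports "HOL-Probability.Probability" "HOL-Library.Ramsey"
begin

text \<open>A graph is a finite vertex set \<open>V\<close> with a set \<open>E\<close> of two-element subsets of \<open>V\<close>;
  \<open>nsets V 2\<close> is the set of all unordered pairs of distinct vertices.\<close>

definition simple_graph :: "'a set \<Rightarrow> 'a set set \<Rightarrow> bool" where
  "simple_graph V E \<longleftrightarrow> finite V \<and> E \<subseteq> nsets V 2"

definition component :: "'a set \<Rightarrow> 'a set set \<Rightarrow> 'a \<Rightarrow> 'a set" where
  "component V E v = {u \<in> V. (v, u) \<in> {(x, y). {x, y} \<in> E}\<^sup>*}"

definition susceptibility :: "'a set \<Rightarrow> 'a set set \<Rightarrow> real" where
  "susceptibility V E = (\<Sum>v\<in>V. real (card (component V E v))) / real (card V)"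

definition component_tail :: "real \<Rightarrow> real \<Rightarrow> 'a set \<Rightarrow> 'a set set \<Rightarrow> bool" where
  "component_tail K c V E \<longleftrightarrow>
     (\<forall>s::nat. s \<ge> 1 \<longrightarrow>
        real (card {v \<in> V. card (component V E v) \<ge> s}) \<le> K * exp (- c * real s) * real (card V))"

text \<open>The distribution of the edge set after adding \<open>m\<close> independent uniformly random edges.
  The sampled edges form a list, possibly with repetitions; the union discards repeated edges.
  The uniform distribution is meaningful only if \<open>V\<close> has at least two elements.\<close>

definition add_random_edges :: "'a set \<Rightarrow> 'a set set \<Rightarrow> nat \<Rightarrow> 'a set set pmf" where
  "add_random_edges V E m =
     map_pmf (\<lambda>es. E \<union> set es) (replicate_pmf m (pmf_of_set (nsets V 2)))"

end

(* The susceptibility is controlled through the exponential moment g(z), the average over the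
   vertices v of exp (z * C_v), where C_v is the order of the component of v. Merging random
   components drives g along Burgers' equation, so g is a supermartingale along the characteristic
   on which z decreases at rate proportional to g - 1, which is about z * S. Along it g - 1 stays
   fixed, S is at most (g - 1) / z, and z / (g - 1) loses about 2 / n per edge, starting from about
   1 / L and ending near gamma / L.

   For the concentration the moment is split at a size A = const * log n. The part from the
   components of size at most A satisfies the same drift inequality by itself and has small jumps,
   so it is bounded by an exponential supermartingale. The part from the larger components, taken
   with a much smaller exponent, is tiny in expectation as long as no two large components merge;
   such a merge is unlikely because few vertices lie in large components. This needs the exponent
   to stay nearly constant, so the edges are added in boundedly many short rounds. *)

theory Submission
  imports Defs "HOL-Real_Asymp.Real_Asymp"
begin

section \<open>Components and component averages\<close>

lemma sym_adjacency: "sym ({(x, y). {x, y} \<in> E}\<^sup>*)"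
  by (rule sym_rtrancl) (auto simp: sym_def insert_commute)

lemma finite_component [simp]: "finite V \<Longrightarrow> finite (component V E v)"
  by (simp add: component_def)

lemma self_in_component: "v \<in> V \<Longrightarrow> v \<in> component V E v"
  by (simp add: component_def)

lemma component_subset: "component V E v \<subseteq> V"
  by (auto simp: component_def)

lemma component_eqI:
  assumes "u \<in> component V E v"
  shows "component V E u = component V E v"
proof -
  have "(v, u) \<in> {(x, y). {x, y} \<in> E}\<^sup>*" "(u, v) \<in> {(x, y). {x, y} \<in> E}\<^sup>*"
    using assms symD[OF sym_adjacency] by (auto simp: component_def)
  then show ?thesis
    by (auto simp: component_def dest: rtrancl_trans)
qed

lemma component_disjoint:
  assumes "v \<notin> component V E u" "v \<in> V"
  shows "component V E u \<inter> component V E v = {}"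
  using assms component_eqI self_in_component by (metis disjoint_iff)

text \<open>After shortcuts a path uses the new edge at most once, in one of its two directions. If
  \<open>u\<close> and \<open>v\<close> are already connected, the union is the old component, so no
  case distinction is needed.\<close>

lemma component_insert:
  assumes "u \<in> V" "v \<in> V" "x \<in> V"
  shows "component V (insert {u, v} E) x =
    (if x \<in> component V E u \<union> component V E v then component V E u \<union> component V E v
     else component V E x)"
proof -
  let ?R = "{(x, y). {x, y} \<in> E}"
  have eq: "{(x, y). {x, y} \<in> insert {u, v} E} = insert (u, v) (insert (v, u) ?R)"
    by (auto simp: doubleton_eq_iff)
  have sy: "(a, b) \<in> ?R\<^sup>* \<longleftrightarrow> (b, a) \<in> ?R\<^sup>*" for a b
    using symD[OF sym_adjacency] by metis
  have "(x, w) \<in> (insert (u, v) (insert (v, u) ?R))\<^sup>* \<longleftrightarrow>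
      (x, w) \<in> ?R\<^sup>* \<or> (x, u) \<in> ?R\<^sup>* \<and> (v, w) \<in> ?R\<^sup>* \<or> (x, v) \<in> ?R\<^sup>* \<and> (u, w) \<in> ?R\<^sup>*" for w
    by (auto simp: rtrancl_insert intro: rtrancl_trans)
  then show ?thesis
    unfolding component_def eq using assms
    by (auto intro: rtrancl_trans dest: sy[THEN iffD1])
qed

text \<open>One form for everything that is tracked: \<open>real\<close> gives the susceptibility,
  indicators give tail fractions, exponentials give the moments. The average is over vertices, so a
  component of order \<open>s\<close> enters with weight \<open>s\<close>.\<close>

definition comp_avg :: "'a set \<Rightarrow> 'a set set \<Rightarrow> (nat \<Rightarrow> real) \<Rightarrow> real" where
  "comp_avg V E \<phi> = (\<Sum>v\<in>V. \<phi> (card (component V E v))) / real (card V)"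

lemma susceptibility_eq_comp_avg: "susceptibility V E = comp_avg V E real"
  by (simp add: susceptibility_def comp_avg_def)

lemma comp_avg_mono:
  assumes "\<And>v. v \<in> V \<Longrightarrow> \<phi> (card (component V E v)) \<le> \<psi> (card (component V E v))"
  shows "comp_avg V E \<phi> \<le> comp_avg V E \<psi>"
  unfolding comp_avg_def by (intro divide_right_mono sum_mono assms) auto

lemma comp_avg_nonneg: "(\<And>s. \<phi> s \<ge> 0) \<Longrightarrow> comp_avg V E \<phi> \<ge> 0"
  unfolding comp_avg_def by (intro divide_nonneg_nonneg sum_nonneg) auto

lemma comp_avg_add: "comp_avg V E (\<lambda>s. \<phi> s + \<psi> s) = comp_avg V E \<phi> + comp_avg V E \<psi>"
  by (simp add: comp_avg_def sum.distrib add_divide_distrib)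

lemma comp_avg_diff: "comp_avg V E (\<lambda>s. \<phi> s - \<psi> s) = comp_avg V E \<phi> - comp_avg V E \<psi>"
  by (simp add: comp_avg_def sum_subtractf diff_divide_distrib)

lemma comp_avg_cmult: "comp_avg V E (\<lambda>s. r * \<phi> s) = r * comp_avg V E \<phi>"
  by (simp add: comp_avg_def sum_distrib_left)

lemma comp_avg_const: "finite V \<Longrightarrow> V \<noteq> {} \<Longrightarrow> comp_avg V E (\<lambda>_. r) = r"
  by (simp add: comp_avg_def)

lemma comp_avg_indicator:
  "finite V \<Longrightarrow> comp_avg V E (\<lambda>s. of_bool (P s)) =
    real (card {v \<in> V. P (card (component V E v))}) / real (card V)"
  by (simp add: comp_avg_def of_bool_def sum.If_cases Int_def)

lemma comp_avg_insert_same: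
  assumes "u \<in> V" "v \<in> component V E u"
  shows "comp_avg V (insert {u, v} E) \<phi> = comp_avg V E \<phi>"
proof -
  have "v \<in> V" using assms component_subset by fast
  then have "component V (insert {u, v} E) x = component V E x" if "x \<in> V" for x
    using component_insert[OF assms(1) \<open>v \<in> V\<close> that, of E] component_eqI[OF assms(2)]
      component_eqI[of x V E u] by auto
  then show ?thesis by (simp add: comp_avg_def)
qed

text \<open>A component of order \<open>s\<close> contributes \<open>s * \<phi> s\<close> to the sum
  over the vertices, and only the two merged components change their contribution.\<close>

lemma comp_avg_insert_merge:
  fixes V :: "'a set"
  assumes fin: "finite V" and uv: "u \<in> V" "v \<in> V" "v \<notin> component V E u"
  defines "a \<equiv> card (component V E u)" and "b \<equiv> card (component V E v)"
  shows "comp_avg V (insert {u, v} E) \<phi> = comp_avg V E \<phi> +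
    (real (a + b) * \<phi> (a + b) - real a * \<phi> a - real b * \<phi> b) / real (card V)"
proof -
  let ?A = "component V E u" and ?B = "component V E v"
  let ?f = "\<lambda>x. \<phi> (card (component V E x))"
  let ?g = "\<lambda>x. \<phi> (card (component V (insert {u, v} E) x))"
  have disj: "?A \<inter> ?B = {}" using component_disjoint uv by metis
  have cAB: "card (?A \<union> ?B) = a + b"
    using disj fin by (simp add: a_def b_def card_Un_disjoint)
  have V: "V = (V - (?A \<union> ?B)) \<union> (?A \<union> ?B)" using component_subset by fast
  have split: "sum h V = sum h (V - (?A \<union> ?B)) + (sum h ?A + sum h ?B)" for h :: "'a \<Rightarrow> real"
    using disj fin by (subst V, subst sum.union_disjoint) (auto simp: sum.union_disjoint)
  have g1: "sum ?g (V - (?A \<union> ?B)) = sum ?f (V - (?A \<union> ?B))"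
    by (intro sum.cong) (auto simp: component_insert uv)
  have "?g x = \<phi> (a + b)" if "x \<in> ?A \<union> ?B" for x
  proof -
    have "x \<in> V" using that component_subset by fast
    then show ?thesis using that component_insert[OF uv(1,2), of x E] cAB by simp
  qed
  then have "sum ?g ?A = a * \<phi> (a + b)" "sum ?g ?B = b * \<phi> (a + b)"
    by (simp_all add: a_def b_def)
  moreover have "sum ?f ?A = a * \<phi> a" "sum ?f ?B = b * \<phi> b"
    using component_eqI[of _ V E] by (simp_all add: a_def b_def)
  ultimately have "sum ?g V = sum ?f V + (real (a + b) * \<phi> (a + b) - real a * \<phi> a - real b * \<phi> b)"
    using split[of ?g] split[of ?f] g1 by (simp add: algebra_simps)
  then show ?thesis by (simp add: comp_avg_def add_divide_distrib diff_divide_distrib)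
qed

section \<open>One random edge\<close>

text \<open>Each unordered pair comes from exactly two ordered pairs, which turns averages over a
  random edge into double sums over its endpoints.\<close>

lemma sum_nsets_2:
  fixes F :: "'a set \<Rightarrow> real"
  assumes "finite V"
  shows "2 * (\<Sum>e\<in>nsets V 2. F e) = (\<Sum>u\<in>V. \<Sum>v\<in>V - {u}. F {u, v})"
proof -
  let ?P = "SIGMA u:V. V - {u}"
  have "(\<Sum>u\<in>V. \<Sum>v\<in>V - {u}. F {u, v}) = (\<Sum>p\<in>?P. F {fst p, snd p})"
    using assms by (subst sum.Sigma) (auto simp: case_prod_beta)
  also have "\<dots> = (\<Sum>e\<in>nsets V 2. \<Sum>p\<in>{p\<in>?P. {fst p, snd p} = e}. F {fst p, snd p})"
    using assms by (intro sum.group[symmetric]) (auto simp: finite_imp_finite_nsets)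
  also have "\<dots> = (\<Sum>e\<in>nsets V 2. 2 * F e)"
  proof (rule sum.cong)
    fix e assume "e \<in> nsets V 2"
    then obtain x y where xy: "e = {x, y}" "x \<in> V" "y \<in> V" "x \<noteq> y"
      by (auto simp: nsets_2_eq)
    then have "{p\<in>?P. {fst p, snd p} = e} = {(x, y), (y, x)}"
      by (auto simp: doubleton_eq_iff)
    then show "(\<Sum>p\<in>{p\<in>?P. {fst p, snd p} = e}. F {fst p, snd p}) = 2 * F e"
      using xy by (simp add: insert_commute)
  qed simp
  finally show ?thesis by (simp add: sum_distrib_left)
qed

lemma real_card_nsets_2:
  assumes "finite V"
  shows "2 * real (card (nsets V 2)) = real (card V) * (real (card V) - 1)"
proof -
  have "2 * real (card (nsets V 2)) = (\<Sum>u\<in>V. \<Sum>v\<in>V - {u}. 1)"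
    using sum_nsets_2[OF assms, of "\<lambda>_. 1"] by simp
  also have "\<dots> = (\<Sum>u\<in>V. real (card V) - 1)"
  proof (rule sum.cong)
    fix u assume "u \<in> V"
    then show "(\<Sum>v\<in>V - {u}. 1) = real (card V) - 1"
      using card_Suc_Diff1[OF assms, of u] by simp
  qed simp
  finally show ?thesis by simp
qed

text \<open>Since \<open>J\<close> is nonnegative, the diagonal \<open>u = v\<close> may be added to
  the ordered pairs. The result is a full double sum, which later splits into products of component
  averages.\<close>

lemma random_pair_avg_le:
  fixes V :: "'a set"
  assumes fin: "finite V" and n2: "card V \<ge> 2"
    and F: "\<And>u v. u \<in> V \<Longrightarrow> v \<in> V \<Longrightarrow> u \<noteq> v \<Longrightarrow>
      F {u, v} \<le> r + J (card (component V E u)) (card (component V E v))"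
    and J: "\<And>a b. J a b \<ge> 0"
  shows "(\<Sum>e\<in>nsets V 2. F e) / card (nsets V 2) \<le>
    r + (\<Sum>u\<in>V. \<Sum>v\<in>V. J (card (component V E u)) (card (component V E v)))
      / (real (card V) * (real (card V) - 1))"
proof -
  let ?N = "real (card V) * (real (card V) - 1)"
  let ?S = "\<Sum>u\<in>V. \<Sum>v\<in>V. J (card (component V E u)) (card (component V E v))"
  have N: "?N > 0" using n2 by auto
  have "(\<Sum>e\<in>nsets V 2. F e) / card (nsets V 2) = (\<Sum>u\<in>V. \<Sum>v\<in>V - {u}. F {u, v}) / ?N"
    unfolding sum_nsets_2[OF fin, symmetric] real_card_nsets_2[OF fin, symmetric] by simp
  also have "(\<Sum>u\<in>V. \<Sum>v\<in>V - {u}. F {u, v}) \<le>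
      (\<Sum>u\<in>V. \<Sum>v\<in>V - {u}. r + J (card (component V E u)) (card (component V E v)))"
    by (intro sum_mono F) auto
  also have "\<dots> = (\<Sum>u\<in>V. \<Sum>v\<in>V - {u}. r) +
      (\<Sum>u\<in>V. \<Sum>v\<in>V - {u}. J (card (component V E u)) (card (component V E v)))"
    by (simp add: sum.distrib)
  also have "(\<Sum>u\<in>V. \<Sum>v\<in>V - {u}. r) = ?N * r"
    unfolding sum_nsets_2[OF fin, of "\<lambda>_. r", symmetric] real_card_nsets_2[OF fin, symmetric]
    by simp
  also have "(\<Sum>u\<in>V. \<Sum>v\<in>V - {u}. J (card (component V E u)) (card (component V E v))) \<le> ?S"
    using fin J by (intro sum_mono sum_mono2) auto
  finally have "(\<Sum>e\<in>nsets V 2. F e) / card (nsets V 2) \<le> (?N * r + ?S) / ?N"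
    using N by (simp add: divide_right_mono)
  also have "\<dots> = r + ?S / ?N"
  proof -
    have "(N * r + S) / N = r + S / N" if "N > 0" for N S :: real
      using that by (simp add: field_simps)
    then show ?thesis using N .
  qed
  finally show ?thesis .
qed

section \<open>The edge process as a Markov chain\<close>

lemma add_random_edges_0: "add_random_edges V E 0 = return_pmf E"
  by (simp add: add_random_edges_def)

text \<open>Exposes the first edge, as fits an induction on the number of edges still to
  come.\<close>

lemma add_random_edges_Suc:
  "add_random_edges V E (Suc m) =
    bind_pmf (pmf_of_set (nsets V 2)) (\<lambda>e. add_random_edges V (insert e E) m)"
  by (simp add: add_random_edges_def map_bind_pmf map_pmf_def bind_assoc_pmf bind_return_pmf)

text \<open>Independence of the edges lets the process restart from its current state; this
  justifies adding them in rounds.\<close>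

lemma add_random_edges_add:
  "add_random_edges V E (m + k) =
    bind_pmf (add_random_edges V E m) (\<lambda>E'. add_random_edges V E' k)"
  by (induction m arbitrary: E)
     (simp_all add: add_random_edges_0 add_random_edges_Suc bind_return_pmf bind_assoc_pmf)

lemma measure_pmf_prob_bind:
  "measure_pmf.prob (bind_pmf p f) B = measure_pmf.expectation p (\<lambda>x. measure_pmf.prob (f x) B)"
proof -
  have "ennreal (measure_pmf.prob (bind_pmf p f) B) = (\<integral>\<^sup>+x. ennreal (measure_pmf.prob (f x) B) \<partial>p)"
    by (simp add: measure_pmf.emeasure_eq_measure[symmetric])
  also have "\<dots> = ennreal (measure_pmf.expectation p (\<lambda>x. measure_pmf.prob (f x) B))"
    by (intro nn_integral_eq_integral measure_pmf.integrable_const_bound[where B = 1]) auto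
  finally show ?thesis by (simp add: integral_nonneg)
qed

lemma prob_add_random_edges_Suc:
  assumes "finite V" "card V \<ge> 2"
  shows "measure_pmf.prob (add_random_edges V E (Suc m)) B =
    (\<Sum>e\<in>nsets V 2. measure_pmf.prob (add_random_edges V (insert e E) m) B) / card (nsets V 2)"
proof -
  have "nsets V 2 \<noteq> {}" using assms by (simp add: nsets_eq_empty_iff)
  then show ?thesis using assms
    by (simp add: add_random_edges_Suc measure_pmf_prob_bind integral_pmf_of_set
        finite_imp_finite_nsets)
qed

text \<open>The index of \<open>\<Phi>\<close> and \<open>bad\<close> counts the edges still to be added. A bad state costs at most 1
  and therefore needs no drift condition: this plays the role of a stopping time.\<close>

lemma supermartingale_bound:
  fixes \<Phi> :: "nat \<Rightarrow> 'a set set \<Rightarrow> real"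
  assumes V: "finite V" "card V \<ge> 2"
    and bad: "\<And>k E. bad k E \<Longrightarrow> \<Phi> k E \<ge> 1" and nonneg: "\<And>k E. \<Phi> k E \<ge> 0"
    and step: "\<And>k E. k < m \<Longrightarrow> \<not> bad (Suc k) E \<Longrightarrow>
      (\<Sum>e\<in>nsets V 2. \<Phi> k (insert e E)) / card (nsets V 2) \<le> \<Phi> (Suc k) E"
  shows "measure_pmf.prob (add_random_edges V E m) {E'. bad 0 E'} \<le> \<Phi> m E"
  using step
proof (induction m arbitrary: E)
  case 0
  then show ?case using bad nonneg by (auto simp: add_random_edges_0 indicator_def)
next
  case (Suc m)
  show ?case
  proof (cases "bad (Suc m) E")
    case True
    then show ?thesis using bad by (meson measure_pmf.prob_le_1 order_trans)
  next
    case False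
    have "measure_pmf.prob (add_random_edges V E (Suc m)) {E'. bad 0 E'} \<le>
        (\<Sum>e\<in>nsets V 2. \<Phi> m (insert e E)) / card (nsets V 2)"
      unfolding prob_add_random_edges_Suc[OF V]
      by (intro divide_right_mono sum_mono Suc.IH Suc.prems) auto
    also have "\<dots> \<le> \<Phi> (Suc m) E" using Suc.prems False by simp
    finally show ?thesis .
  qed
qed

section \<open>Truncated exponential moments\<close>

text \<open>Sizes above \<open>A\<close> are dropped from \<open>small_exp\<close>, so a merge that produces such a size only
  lowers its average. Hence its drift is bounded in terms of the truncated moments alone.\<close>

definition small_exp :: "real \<Rightarrow> real \<Rightarrow> nat \<Rightarrow> real" where
  "small_exp A z s = (if real s \<le> A then exp (z * real s) - 1 else 0)"

definition big_exp :: "real \<Rightarrow> real \<Rightarrow> nat \<Rightarrow> real" where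
  "big_exp A w s = (if real s \<le> A then 0 else exp (w * real s))"

definition small_exp_deriv :: "real \<Rightarrow> real \<Rightarrow> nat \<Rightarrow> real" where
  "small_exp_deriv A z s = (if real s \<le> A then real s * exp (z * real s) else 0)"

definition big_exp_deriv :: "real \<Rightarrow> real \<Rightarrow> nat \<Rightarrow> real" where
  "big_exp_deriv A w s = (if real s \<le> A then 0 else real s * exp (w * real s))"

lemma small_exp_nonneg [simp]: "z \<ge> 0 \<Longrightarrow> small_exp A z s \<ge> 0"
  by (simp add: small_exp_def)

lemma big_exp_nonneg [simp]: "big_exp A w s \<ge> 0"
  by (simp add: big_exp_def)

lemma small_exp_deriv_nonneg [simp]: "small_exp_deriv A z s \<ge> 0"
  by (simp add: small_exp_deriv_def)

lemma big_exp_deriv_nonneg [simp]: "big_exp_deriv A w s \<ge> 0"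
  by (simp add: big_exp_deriv_def)

lemma exp_tangent: "exp y + h * exp y \<le> exp (y + h)" for y h :: real
  using exp_ge_add_one_self[of h] mult_left_mono[of "1 + h" "exp h" "exp y"]
  by (simp add: exp_add algebra_simps)

text \<open>The cutoff depends on \<open>s\<close> alone, so the tangent inequality survives it. A
  raise of the exponent by \<open>h\<close> thus pays for a drift of \<open>h\<close> times the
  derivative.\<close>

lemma small_exp_tangent:
  "small_exp A z s + h * small_exp_deriv A z s \<le> small_exp A (z + h) s"
  using exp_tangent[of "z * real s" "h * real s"]
  by (simp add: small_exp_def small_exp_deriv_def algebra_simps)

lemma big_exp_tangent:
  "big_exp A w s + h * big_exp_deriv A w s \<le> big_exp A (w + h) s"
  using exp_tangent[of "w * real s" "h * real s"]
  by (simp add: big_exp_def big_exp_deriv_def algebra_simps)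

lemma exp_minus_one_convex:
  fixes y t :: real
  assumes "0 \<le> t" "t \<le> 1"
  shows "exp (t * y) - 1 \<le> t * (exp y - 1)"
proof -
  have "exp ((1 - t) * 0 + t * y) \<le> (1 - t) * exp 0 + t * exp y"
    using convex_onD[OF exp_convex, of t 0 y] assms by simp
  then show ?thesis by (simp add: algebra_simps)
qed

text \<open>Convexity along the chord from 0. The gained factor \<open>t\<close> matters for the
  large part: its exponent is \<open>\<theta>\<close> times the main one, so it also falls
  \<open>\<theta>\<close> times as fast.\<close>

lemma small_exp_scale:
  assumes "0 \<le> t" "t \<le> 1"
  shows "small_exp A (t * z) s \<le> t * small_exp A z s"
  using exp_minus_one_convex[OF assms, of "z * real s"] by (simp add: small_exp_def mult.assoc)

text \<open>Half of the exponent is left to absorb the factor \<open>s\<close>: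
  \<open>z * s / 2 * exp (z * s / 2)\<close> is at most \<open>exp (z * s) - exp (z * s / 2)\<close>
  by the tangent at \<open>z * s / 2\<close>.\<close>

lemma small_exp_deriv_le:
  assumes "z > 0" "w \<le> z / 2"
  shows "small_exp_deriv A w s \<le> 2 / z * small_exp A z s"
proof (cases "real s \<le> A")
  case True
  have "real s * exp (w * real s) \<le> real s * exp (z * real s / 2)"
    using mult_right_mono[OF assms(2), of "real s"] by (intro mult_left_mono) auto
  also have "\<dots> \<le> 2 / z * (exp (z * real s) - exp (z * real s / 2))"
    using exp_tangent[of "z * real s / 2" "z * real s / 2"] assms by (simp add: field_simps)
  also have "\<dots> \<le> 2 / z * (exp (z * real s) - 1)"
    using assms by (intro mult_left_mono) auto
  finally show ?thesis using True by (simp add: small_exp_def small_exp_deriv_def)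
qed (simp add: small_exp_def small_exp_deriv_def)

text \<open>For small jumps the second-order term costs only the factor \<open>1 + \<xi>\<close>,
  which is later paid by a slightly faster fall of the exponent.\<close>

lemma exp_le_quadratic:
  fixes x y \<xi> :: real
  assumes "0 \<le> x" "x \<le> \<xi>" "\<xi> \<le> 1"
  shows "exp x \<le> 1 + (1 + \<xi>) * x"
proof -
  have "exp x \<le> 1 + x + x\<^sup>2" using exp_bound assms by simp
  also have "x\<^sup>2 \<le> \<xi> * x" using assms by (simp add: power2_eq_square mult_right_mono)
  finally show ?thesis by (simp add: algebra_simps)
qed

lemma sum_product_comp_avg:
  assumes "finite V" "V \<noteq> {}"
  shows "(\<Sum>u\<in>V. \<Sum>v\<in>V. \<phi> (card (component V E u)) * \<psi> (card (component V E v))) =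
    (real (card V))\<^sup>2 * (comp_avg V E \<phi> * comp_avg V E \<psi>)"
  unfolding sum_product[symmetric] using assms by (simp add: comp_avg_def power2_eq_square)

lemma sum_sum_scale:
  "(\<Sum>u\<in>V. \<Sum>v\<in>V. k * f u v) = (k :: real) * (\<Sum>u\<in>V. \<Sum>v\<in>V. f u v)"
  by (simp add: sum_distrib_left)

text \<open>With \<open>x = exp (z * a)\<close> and \<open>y = exp (z * b)\<close>, the change is
  \<open>a * x * (y - 1) + b * y * (x - 1)\<close> as long as \<open>a + b\<close> stays below the
  cutoff. Above it the merged component counts 0, so the change is nonpositive. The bound on
  \<open>J\<close> limits the size of a jump.\<close>

lemma small_exp_merge:
  fixes a b :: nat and A z :: real
  assumes "z \<ge> 0" "a \<ge> 1" "b \<ge> 1"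
  defines "D \<equiv> real (a + b) * small_exp A z (a + b) - real a * small_exp A z a - real b * small_exp A z b"
  defines "J \<equiv> small_exp_deriv A z a * small_exp A z b + small_exp A z a * small_exp_deriv A z b"
  shows "D \<le> 0 \<or> D = J \<and> J \<le> A * exp (z * A)"
proof (cases "real (a + b) \<le> A")
  case True
  have "D = J" using True
    by (simp add: D_def J_def small_exp_def small_exp_deriv_def exp_add algebra_simps)
  moreover have "D \<le> real (a + b) * exp (z * real (a + b))"
    using True assms(1) by (simp add: D_def small_exp_def algebra_simps add_increasing)
  moreover have "\<dots> \<le> A * exp (z * A)"
    using True assms(1) by (intro mult_mono) (auto simp: mult_left_mono)
  ultimately show ?thesis by auto
next
  case False
  then have "small_exp A z (a + b) = 0" by (simp add: small_exp_def)
  moreover have "real a * small_exp A z a \<ge> 0" "real b * small_exp A z b \<ge> 0"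
    using assms(1) by (auto intro: mult_nonneg_nonneg)
  ultimately have "D \<le> 0" unfolding D_def by (simp only: mult_zero_right)
  then show ?thesis by simp
qed

lemma card_component_pos: "finite V \<Longrightarrow> u \<in> V \<Longrightarrow> card (component V E u) \<ge> 1"
  using self_in_component[of u V E] by (simp add: Suc_le_eq card_gt_0_iff) auto

text \<open>A Chernoff-type step: bounded jumps allow the exponential to be linearised.
  \<open>Q\<close> is the derivative of \<open>X\<close> in \<open>z\<close>, so
  \<open>2 * Q * X / (n - 1)\<close>, with \<open>n\<close> the number of vertices, is the discrete
  form of the Burgers term.\<close>

lemma avg_exp_small_le:
  fixes V :: "'a set" and E :: "'a set set" and A z \<tau> \<xi> \<delta> :: real
  assumes V: "finite V" "card V \<ge> 2" and z: "z \<ge> 0" and lam: "\<tau> \<ge> 0" and xi: "0 \<le> \<xi>" "\<xi> \<le> 1"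
    and jump: "\<tau> * (A * exp (z * A)) / card V \<le> \<xi>"
  defines "X \<equiv> comp_avg V E (small_exp A z)" and "Q \<equiv> comp_avg V E (small_exp_deriv A z)"
  shows "(\<Sum>e\<in>nsets V 2. exp (\<tau> * (comp_avg V (insert e E) (small_exp A z) - \<delta>))) / card (nsets V 2)
    \<le> exp (\<tau> * (X + (1 + \<xi>) * (2 / (real (card V) - 1)) * (Q * X) - \<delta>))"
proof -
  let ?n = "real (card V)" and ?c = "exp (\<tau> * (X - \<delta>))"
  (* Pairs inside one component or with too large a sum do not raise the average, but J is kept
     for them: it is nonnegative, and the full double sum factorises. *)
  define J where "J = (\<lambda>a b. small_exp_deriv A z a * small_exp A z b + small_exp A z a * small_exp_deriv A z b)"
  have n: "?n > 1" and ne: "V \<noteq> {}" using V by auto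
  have J0: "J a b \<ge> 0" for a b using z by (simp add: J_def)
  define C where "C = ?c * ((1 + \<xi>) * (\<tau> / ?n))"
  have C0: "C \<ge> 0" using lam xi by (simp add: C_def)
  have le: "exp (\<tau> * (comp_avg V (insert {u, v} E) (small_exp A z) - \<delta>)) \<le>
      ?c + C * J (card (component V E u)) (card (component V E v))"
    if uv: "u \<in> V" "v \<in> V" "u \<noteq> v" for u v
  proof (cases "v \<in> component V E u")
    case True
    then show ?thesis using comp_avg_insert_same[OF uv(1) True] C0 J0 by (simp add: X_def)
  next
    case False
    define a b where "a = card (component V E u)" and "b = card (component V E v)"
    define D where "D = real (a + b) * small_exp A z (a + b) - real a * small_exp A z a - real b * small_exp A z b"
    have eq: "comp_avg V (insert {u, v} E) (small_exp A z) = X + D / ?n"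
      using comp_avg_insert_merge[OF V(1) uv(1,2) False] by (simp add: X_def D_def a_def b_def)
    have "exp (\<tau> * (D / ?n)) \<le> 1 + (1 + \<xi>) * (\<tau> / ?n) * J a b"
    proof (cases "D \<le> 0")
      case True
      then have "exp (\<tau> * (D / ?n)) \<le> 1"
        using lam by (simp add: mult_nonneg_nonpos divide_nonpos_nonneg)
      also have "\<dots> \<le> 1 + (1 + \<xi>) * (\<tau> / ?n) * J a b" using lam xi J0 by simp
      finally show ?thesis .
    next
      case D: False
      have "a \<ge> 1" "b \<ge> 1" using card_component_pos[OF V(1)] uv by (auto simp: a_def b_def)
      from small_exp_merge[OF z this, of A] D have DJ: "D = J a b" "J a b \<le> A * exp (z * A)"
        by (auto simp: D_def J_def)
      have "\<tau> * (D / ?n) \<le> \<tau> * (A * exp (z * A)) / ?n"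
        using DJ lam n by (simp add: mult_left_mono divide_right_mono)
      then have "exp (\<tau> * (D / ?n)) \<le> 1 + (1 + \<xi>) * (\<tau> * (D / ?n))"
        using D lam n jump xi by (intro exp_le_quadratic) auto
      then show ?thesis using DJ by simp
    qed
    then have "?c * exp (\<tau> * (D / ?n)) \<le> ?c * (1 + (1 + \<xi>) * (\<tau> / ?n) * J a b)"
      by (intro mult_left_mono) auto
    then show ?thesis unfolding eq C_def a_def[symmetric] b_def[symmetric]
      by (simp add: algebra_simps flip: exp_add)
  qed
  have S: "(\<Sum>u\<in>V. \<Sum>v\<in>V. C * J (card (component V E u)) (card (component V E v))) =
      C * (2 * ?n\<^sup>2 * (Q * X))"
    unfolding sum_sum_scale J_def sum.distrib sum_product_comp_avg[OF V(1) ne]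
    by (simp add: X_def Q_def mult.commute)
  have "(\<Sum>e\<in>nsets V 2. exp (\<tau> * (comp_avg V (insert e E) (small_exp A z) - \<delta>))) / card (nsets V 2)
      \<le> ?c + C * (2 * ?n\<^sup>2 * (Q * X)) / (?n * (?n - 1))"
    unfolding S[symmetric]
    by (rule random_pair_avg_le[OF V, where J = "\<lambda>a b. C * J a b"]) (use le C0 J0 in auto)
  also have "\<dots> = ?c * (1 + \<tau> * ((1 + \<xi>) * (2 / (?n - 1)) * (Q * X)))"
    using n by (simp add: C_def field_simps power2_eq_square)
  also have "\<dots> \<le> ?c * exp (\<tau> * ((1 + \<xi>) * (2 / (?n - 1)) * (Q * X)))"
    by (intro mult_left_mono exp_ge_add_one_self) auto
  also have "\<dots> = exp (\<tau> * (X + (1 + \<xi>) * (2 / (?n - 1)) * (Q * X) - \<delta>))"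
    by (simp add: algebra_simps flip: exp_add)
  finally show ?thesis .
qed

text \<open>Two small components matter only if \<open>a + b\<close> exceeds \<open>A\<close>. Then
  the gap \<open>z - w\<close> between the exponents gains \<open>exp (- (z - w) * A)\<close>, and
  \<open>a + b\<close> is at most \<open>2 * A\<close>. \<open>small_exp\<close> plus the indicator
  is \<open>exp (z * s)\<close> on small sizes. With one small and one large component the product
  rule of \<open>small_exp_merge\<close> holds with equality.\<close>

lemma big_exp_merge:
  fixes a b :: nat
  assumes "0 \<le> w" "w \<le> z" "\<not> (real a > A \<and> real b > A)" "A > 0"
  shows "real (a + b) * big_exp A w (a + b) - real a * big_exp A w a - real b * big_exp A w b \<le>
    2 * A * exp (- (z - w) * A) * ((small_exp A z a + of_bool (real a \<le> A)) * (small_exp A z b + of_bool (real b \<le> A)))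
    + (big_exp_deriv A w a * small_exp A w b + big_exp A w a * small_exp_deriv A w b)
    + (small_exp A w a * big_exp_deriv A w b + small_exp_deriv A w a * big_exp A w b)"
proof (cases "real a \<le> A \<and> real b \<le> A")
  case True
  have "real (a + b) * big_exp A w (a + b) \<le> 2 * A * exp (- (z - w) * A) * exp (z * real (a + b))"
  proof (cases "real (a + b) \<le> A")
    case False
    have "w * real (a + b) \<le> w * real (a + b) + (z - w) * (real (a + b) - A)"
      using False assms by simp
    then have "exp (w * real (a + b)) \<le> exp (- (z - w) * A) * exp (z * real (a + b))"
      unfolding exp_add[symmetric] by (subst exp_le_cancel_iff) (simp add: algebra_simps)
    then have "real (a + b) * exp (w * real (a + b)) \<le>
        (2 * A) * (exp (- (z - w) * A) * exp (z * real (a + b)))"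
      using True by (intro mult_mono) auto
    then show ?thesis using False by (simp add: big_exp_def)
  qed (use assms in \<open>simp add: big_exp_def\<close>)
  then show ?thesis using True
    by (simp add: big_exp_def big_exp_deriv_def small_exp_def exp_add distrib_left)
next
  case False
  then consider "real a > A" "real b \<le> A" | "real b > A" "real a \<le> A" using assms by linarith
  then show ?thesis
    by cases (simp_all add: big_exp_def big_exp_deriv_def small_exp_def small_exp_deriv_def
        exp_add algebra_simps)
qed

text \<open>A merge of two large components can raise the average of \<open>big_exp\<close> enormously. Capping at 1
  bounds its effect by the probability of such a merge, which is the last summand.\<close>

lemma avg_min_big_le:
  fixes V :: "'a set" and E :: "'a set set" and A z w c g :: real
  assumes V: "finite V" "card V \<ge> 2" and w: "0 \<le> w" "w \<le> z" and A: "A > 0" and c: "c \<ge> 0" and g: "g \<ge> 0"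
  defines "T \<equiv> comp_avg V E"
  shows "(\<Sum>e\<in>nsets V 2. min 1 (c * (comp_avg V (insert e E) (big_exp A w) + g))) / card (nsets V 2)
    \<le> c * (T (big_exp A w) + g
        + 2 * A * exp (- (z - w) * A) / (real (card V) - 1) * (T (\<lambda>s. small_exp A z s + of_bool (real s \<le> A)))\<^sup>2
        + 2 / (real (card V) - 1) * (T (big_exp_deriv A w) * T (small_exp A w) + T (big_exp A w) * T (small_exp_deriv A w)))
      + real (card V) / (real (card V) - 1) * (T (\<lambda>s. of_bool (real s > A)))\<^sup>2"
proof -
  let ?n = "real (card V)"
  define H where "H = T (big_exp A w)"
  define P where "P = (\<lambda>s. small_exp A z s + of_bool (real s \<le> A))"
  define B :: "nat \<Rightarrow> real" where "B = (\<lambda>s. of_bool (real s > A))"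
  define k where "k = 2 * A * exp (- (z - w) * A)"
  define J where "J = (\<lambda>a b. k * (P a * P b)
    + (big_exp_deriv A w a * small_exp A w b + big_exp A w a * small_exp_deriv A w b)
    + (small_exp A w a * big_exp_deriv A w b + small_exp_deriv A w a * big_exp A w b))"
  have n: "?n > 1" and ne: "V \<noteq> {}" using V by auto
  have H0: "H \<ge> 0" by (auto simp: H_def T_def intro: comp_avg_nonneg)
  have P0: "P s \<ge> 0" for s using w by (simp add: P_def)
  have J0: "J a b \<ge> 0" for a b using w A P0 by (simp add: J_def k_def)
  have B0: "B a \<ge> 0" for a by (simp add: B_def)
  have le: "min 1 (c * (comp_avg V (insert {u, v} E) (big_exp A w) + g)) \<le>
      c * (H + g) + (c / ?n * J (card (component V E u)) (card (component V E v))
         + B (card (component V E u)) * B (card (component V E v)))"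
    if uv: "u \<in> V" "v \<in> V" "u \<noteq> v" for u v
  proof (cases "v \<in> component V E u")
    case True
    then have "comp_avg V (insert {u, v} E) (big_exp A w) = H"
      using comp_avg_insert_same[OF uv(1) True] by (simp add: H_def T_def)
    then show ?thesis using c J0 B0 by (simp add: min.coboundedI2)
  next
    case False
    define a b where "a = card (component V E u)" and "b = card (component V E v)"
    show ?thesis
    proof (cases "real a > A \<and> real b > A")
      case True
      then have "B a * B b = 1" by (simp add: B_def)
      then show ?thesis unfolding a_def[symmetric] b_def[symmetric]
        using c J0 H0 g by (simp add: min.coboundedI1)
    next
      case nb: False
      have "comp_avg V (insert {u, v} E) (big_exp A w) = H +
          (real (a + b) * big_exp A w (a + b) - real a * big_exp A w a - real b * big_exp A w b) / ?n"
        using comp_avg_insert_merge[OF V(1) uv(1,2) False] by (simp add: H_def T_def a_def b_def)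
      also have "\<dots> \<le> H + J a b / ?n"
        unfolding J_def P_def k_def by (intro add_mono divide_right_mono big_exp_merge w nb A) auto
      finally have "c * (comp_avg V (insert {u, v} E) (big_exp A w) + g) \<le> c * (H + J a b / ?n + g)"
        using c by (intro mult_left_mono) auto
      also have "\<dots> \<le> c * (H + g) + (c / ?n * J a b + B a * B b)"
        using B0[of a] B0[of b] by (simp add: algebra_simps)
      finally show ?thesis unfolding a_def b_def by (simp add: min.coboundedI2)
    qed
  qed
  define W where "W = k * (T P)\<^sup>2 + 2 * (T (big_exp_deriv A w) * T (small_exp A w) + H * T (small_exp_deriv A w))"
  note sp = sum_product_comp_avg[OF V(1) ne]
  have S: "(\<Sum>u\<in>V. \<Sum>v\<in>V. c / ?n * J (card (component V E u)) (card (component V E v))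
         + B (card (component V E u)) * B (card (component V E v))) =
      c / ?n * (?n\<^sup>2 * W) + ?n\<^sup>2 * (T B)\<^sup>2"
    unfolding sum.distrib sum_sum_scale J_def sum.distrib sum_sum_scale sum_product_comp_avg[OF V(1) ne]
    by (simp add: W_def T_def H_def power2_eq_square algebra_simps)
  have "(\<Sum>e\<in>nsets V 2. min 1 (c * (comp_avg V (insert e E) (big_exp A w) + g))) / card (nsets V 2)
    \<le> c * (H + g) + (c / ?n * (?n\<^sup>2 * W) + ?n\<^sup>2 * (T B)\<^sup>2) / (?n * (?n - 1))"
    unfolding S[symmetric]
    by (rule random_pair_avg_le[OF V, where J = "\<lambda>a b. c / ?n * J a b + B a * B b"]) (use le c J0 B0 in auto)
  also have "c / ?n * (?n\<^sup>2 * W) + ?n\<^sup>2 * (T B)\<^sup>2 = ?n * (c * W + ?n * (T B)\<^sup>2)"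
    using n by (simp add: power2_eq_square algebra_simps)
  also have "c * (H + g) + \<dots> / (?n * (?n - 1)) = c * (H + g + W / (?n - 1)) + ?n / (?n - 1) * (T B)\<^sup>2"
    using n by (subst mult_divide_mult_cancel_left) (auto simp: add_divide_distrib algebra_simps)
  finally show ?thesis
    by (simp add: W_def H_def B_def P_def k_def add_divide_distrib add.assoc)
qed

section \<open>A short round of random edges\<close>

text \<open>With \<open>k\<close> edges still to come the exponent is \<open>z k\<close>, so it
  falls from \<open>z m\<close> to \<open>\<zeta>\<close> while the level \<open>\<delta>\<close>
  stays fixed. \<open>q\<close> bounds the growth of the large part per edge that the falling
  exponent leaves, \<open>\<beta>\<close> the creation of large components out of small ones, and
  \<open>\<kappa>\<close> the chance that two large ones merge.\<close>

lemma final_state_bound: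
  fixes V :: "'a set" and E :: "'a set set" and A \<zeta> \<Delta> \<theta> \<delta> \<xi> \<tau> h :: real and m :: nat
  assumes V: "finite V" "card V \<ge> 2"
    and pos: "A > 0" "\<zeta> > 0" "\<delta> > 0" "h > 0" "\<tau> \<ge> 0"
    and th: "0 \<le> \<theta>" "\<theta> \<le> 1 / 2" and xi: "0 \<le> \<xi>" "\<xi> \<le> 1"
    and Delta: "\<Delta> \<ge> 2 * \<delta> * (1 + \<xi>) / (real (card V) - 1)"
    and jump: "\<tau> * (A * exp ((\<zeta> + real m * \<Delta>) * A)) / card V \<le> \<xi>"
  defines "q \<equiv> 1 + 4 * \<delta> / (\<zeta> * (real (card V) - 1))"
    and "\<beta> \<equiv> 2 * A * exp (- (1 - \<theta>) * \<zeta> * A) / (real (card V) - 1) * (1 + \<delta>)\<^sup>2"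
    and "\<kappa> \<equiv> real (card V) / (real (card V) - 1) * h\<^sup>2"
    and "z \<equiv> \<lambda>k::nat. \<zeta> + real k * \<Delta>"
  shows "measure_pmf.prob (add_random_edges V E m)
      {E'. comp_avg V E' (small_exp A \<zeta>) > \<delta> \<or> comp_avg V E' (big_exp A (\<theta> * \<zeta>)) > h}
    \<le> exp (\<tau> * (comp_avg V E (small_exp A (z m)) - \<delta>))
      + q ^ m * (comp_avg V E (big_exp A (\<theta> * z m)) + real m * \<beta>) / h + real m * \<kappa>"
proof -
  let ?n = "real (card V)"
  let ?X = "\<lambda>k E. comp_avg V E (small_exp A (z k))"
  let ?H = "\<lambda>k E. comp_avg V E (big_exp A (\<theta> * z k))"
  \<comment> \<open>The power of \<open>q\<close>, \<open>real k * \<beta>\<close> and the later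
    \<open>real k * \<kappa>\<close> are reserves for the remaining \<open>k\<close> edges; one unit
    of each is spent per edge.\<close>
  define G where "G = (\<lambda>k E. q ^ k / h * (?H k E + real k * \<beta>))"
  define \<Phi> where "\<Phi> = (\<lambda>k E. exp (\<tau> * (?X k E - \<delta>)) + min 1 (G k E) + real k * \<kappa>)"
  define bad where "bad = (\<lambda>k E. ?X k E > \<delta> \<or> ?H k E > h)"
  have n: "?n > 1" and ne: "V \<noteq> {}" using V by auto
  have "2 * \<delta> * (1 + \<xi>) / (?n - 1) \<ge> 2 * \<delta> / (?n - 1)"
    using n pos xi by (intro divide_right_mono) auto
  then have D2: "\<Delta> \<ge> 2 * \<delta> / (?n - 1)" using Delta by linarith
  moreover have "2 * \<delta> / (?n - 1) > 0" using n pos by simp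
  ultimately have D0: "\<Delta> > 0" by linarith
  have q1: "q \<ge> 1" using pos n by (simp add: q_def)
  have b0: "\<beta> \<ge> 0" using pos n by (simp add: \<beta>_def)
  have k0: "\<kappa> \<ge> 0" using pos n by (simp add: \<kappa>_def)
  have H0: "?H k E \<ge> 0" for k E by (intro comp_avg_nonneg) auto
  have G0: "G k E \<ge> 0" for k E unfolding G_def using q1 pos b0 H0 by simp
  have zpos: "z k \<ge> \<zeta>" for k using D0 by (simp add: z_def)
  have zSuc: "z (Suc k) = z k + \<Delta>" for k by (simp add: z_def algebra_simps)
  have "measure_pmf.prob (add_random_edges V E m) {E'. bad 0 E'} \<le> \<Phi> m E"
  proof (rule supermartingale_bound[OF V])
    fix k E assume "bad k E"
    then consider "?X k E > \<delta>" | "?H k E > h" by (auto simp: bad_def)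
    then show "\<Phi> k E \<ge> 1"
    proof cases
      case 1
      then have "exp (\<tau> * (?X k E - \<delta>)) \<ge> 1" using pos by simp
      then show ?thesis using G0[of k E] k0 by (simp add: \<Phi>_def add_increasing2)
    next
      case 2
      then have "h \<le> ?H k E + real k * \<beta>" using mult_nonneg_nonneg[of "real k" \<beta>] b0 by linarith
      then have "1 \<le> (?H k E + real k * \<beta>) / h" using pos by simp
      also have "\<dots> \<le> q ^ k * ((?H k E + real k * \<beta>) / h)"
        using mult_right_mono[OF one_le_power[OF q1, of k], of "(?H k E + real k * \<beta>) / h"]
          b0 H0[of E k] pos by simp
      finally have "min 1 (G k E) = 1" by (simp add: G_def)
      then show ?thesis using k0 by (simp add: \<Phi>_def add_increasing)
    qed
  next
    fix k E show "\<Phi> k E \<ge> 0" using G0 k0 by (simp add: \<Phi>_def)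
  next
    fix k E assume km: "k < m" and nb: "\<not> bad (Suc k) E"
    let ?T = "comp_avg V E" and ?w = "\<theta> * z k"
    have zk: "z k > 0" "z k \<ge> \<zeta>" using zpos[of k] pos by linarith+
    have w: "0 \<le> ?w" "?w \<le> z k" "?w \<le> z k / 2" using zk th mult_right_mono[of \<theta> "1/2" "z k"] by auto
    have X0: "?X k E \<ge> 0" using zk by (intro comp_avg_nonneg) auto
    have XS: "?X k E + \<Delta> * ?T (small_exp_deriv A (z k)) \<le> ?X (Suc k) E"
      unfolding comp_avg_cmult[symmetric] comp_avg_add[symmetric] zSuc
      by (intro comp_avg_mono small_exp_tangent)
    have HS: "?H k E + \<theta> * \<Delta> * ?T (big_exp_deriv A ?w) \<le> ?H (Suc k) E"
      unfolding comp_avg_cmult[symmetric] comp_avg_add[symmetric] zSuc distrib_left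
      by (intro comp_avg_mono big_exp_tangent)
    have Q0: "?T (small_exp_deriv A (z k)) \<ge> 0" and R0: "?T (big_exp_deriv A ?w) \<ge> 0"
      by (intro comp_avg_nonneg; simp)+
    \<comment> \<open>Not being bad concerns the larger exponent \<open>z (Suc k)\<close>; the
      tangent inequality hands the bound down to \<open>z k\<close>.\<close>
    have Xd: "?X (Suc k) E \<le> \<delta>" "?X k E \<le> \<delta>" and Hh: "?H (Suc k) E \<le> h"
      using nb XS mult_nonneg_nonneg[OF less_imp_le[OF D0] Q0] by (auto simp: bad_def)
    have "?H k E \<le> ?H (Suc k) E"
      using HS mult_nonneg_nonneg[OF mult_nonneg_nonneg[OF th(1) less_imp_le[OF D0]] R0] by linarith
    have "(\<Sum>e\<in>nsets V 2. exp (\<tau> * (?X k (insert e E) - \<delta>))) / card (nsets V 2) \<le>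
        exp (\<tau> * (?X k E + (1 + \<xi>) * (2 / (?n - 1)) * (?T (small_exp_deriv A (z k)) * ?X k E) - \<delta>))"
    proof (rule avg_exp_small_le[OF V _ pos(5) xi])
      have "\<tau> * (A * exp (z k * A)) / ?n \<le> \<tau> * (A * exp (z m * A)) / ?n"
        using pos n D0 km
        by (intro divide_right_mono mult_left_mono) (auto simp: z_def mult_right_mono)
      then show "\<tau> * (A * exp (z k * A)) / ?n \<le> \<xi>" using jump by (simp add: z_def)
    qed (use zk in simp)
    also have "\<dots> \<le> exp (\<tau> * (?X (Suc k) E - \<delta>))"
    proof -
      \<comment> \<open>One factor of the Burgers drift is replaced by its bound
        \<open>\<delta>\<close>. The drift becomes linear in the derivative, and the difference
        between \<open>z (Suc k)\<close> and \<open>z k\<close> covers it by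
        \<open>XS\<close>.\<close>
      have "(1 + \<xi>) * (2 / (?n - 1)) * (?T (small_exp_deriv A (z k)) * ?X k E) \<le>
          (1 + \<xi>) * (2 / (?n - 1)) * (?T (small_exp_deriv A (z k)) * \<delta>)"
        using Xd Q0 xi n by (intro mult_left_mono) auto
      also have "\<dots> = (2 * \<delta> * (1 + \<xi>) / (?n - 1)) * ?T (small_exp_deriv A (z k))"
        by (simp add: field_simps)
      also have "\<dots> \<le> \<Delta> * ?T (small_exp_deriv A (z k))"
        by (rule mult_right_mono[OF Delta Q0])
      finally show ?thesis using XS pos(5) by (simp add: mult_left_mono)
    qed
    finally have step1: "(\<Sum>e\<in>nsets V 2. exp (\<tau> * (?X k (insert e E) - \<delta>))) / card (nsets V 2) \<le>
      exp (\<tau> * (?X (Suc k) E - \<delta>))" .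
    define c where "c = q ^ k / h"
    have c0: "c \<ge> 0" using q1 pos by (simp add: c_def)
    have P: "0 \<le> ?T (\<lambda>s. small_exp A (z k) s + of_bool (real s \<le> A))"
        "?T (\<lambda>s. small_exp A (z k) s + of_bool (real s \<le> A)) \<le> 1 + \<delta>"
    proof -
      show "0 \<le> ?T (\<lambda>s. small_exp A (z k) s + of_bool (real s \<le> A))"
        using zk by (intro comp_avg_nonneg) simp
      have "?T (\<lambda>s. small_exp A (z k) s + of_bool (real s \<le> A)) \<le> ?T (\<lambda>s. small_exp A (z k) s + 1)"
        by (intro comp_avg_mono) auto
      then show "?T (\<lambda>s. small_exp A (z k) s + of_bool (real s \<le> A)) \<le> 1 + \<delta>"
        using Xd by (simp add: comp_avg_add comp_avg_const V ne)
    qed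
    have e: "2 * A * exp (- (z k - ?w) * A) / (?n - 1) * (?T (\<lambda>s. small_exp A (z k) s + of_bool (real s \<le> A)))\<^sup>2 \<le> \<beta>"
      unfolding \<beta>_def
    proof (intro mult_mono divide_right_mono mult_left_mono power_mono P)
      have "(1 - \<theta>) * \<zeta> * A \<le> (1 - \<theta>) * z k * A"
        using zk th pos by (intro mult_right_mono mult_left_mono) auto
      then show "exp (- (z k - ?w) * A) \<le> exp (- (1 - \<theta>) * \<zeta> * A)" by (simp add: algebra_simps)
    qed (use pos n in auto)
    have Y: "?T (small_exp A ?w) \<le> \<theta> * \<delta>"
    proof -
      have "?T (small_exp A ?w) \<le> ?T (\<lambda>s. \<theta> * small_exp A (z k) s)"
        using th by (intro comp_avg_mono small_exp_scale) auto
      also have "\<dots> \<le> \<theta> * \<delta>" using Xd th by (simp add: comp_avg_cmult mult_left_mono)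
      finally show ?thesis .
    qed
    have Qw: "?T (small_exp_deriv A ?w) \<le> 2 * \<delta> / \<zeta>"
    proof -
      have "?T (small_exp_deriv A ?w) \<le> ?T (\<lambda>s. 2 / z k * small_exp A (z k) s)"
        using zk w by (intro comp_avg_mono small_exp_deriv_le) auto
      also have "\<dots> = 2 / z k * ?X k E" by (rule comp_avg_cmult)
      also have "\<dots> \<le> 2 / \<zeta> * \<delta>" using Xd X0 zk pos by (intro mult_mono frac_le) auto
      finally show ?thesis by simp
    qed
    \<comment> \<open>A vertex in a large component contributes at least 1 to
      \<open>big_exp\<close>, so \<open>h\<close> also bounds the fraction of such vertices.\<close>
    have B: "?T (\<lambda>s. of_bool (real s > A)) \<le> h"
    proof -
      have "?T (\<lambda>s. of_bool (real s > A)) \<le> ?H k E"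
        using w by (intro comp_avg_mono) (auto simp: big_exp_def)
      then show ?thesis using Hh \<open>?H k E \<le> ?H (Suc k) E\<close> by linarith
    qed
    have B0: "0 \<le> ?T (\<lambda>s. of_bool (real s > A))" by (intro comp_avg_nonneg) auto
    \<comment> \<open>The derivative term is paid by the fall of the exponent through
      \<open>HS\<close>; what remains is proportional to the large part itself and gives the factor
      \<open>q\<close>.\<close>
    have "2 / (?n - 1) * (?T (big_exp_deriv A ?w) * ?T (small_exp A ?w) + ?H k E * ?T (small_exp_deriv A ?w))
        \<le> 2 / (?n - 1) * (?T (big_exp_deriv A ?w) * (\<theta> * \<delta>) + ?H k E * (2 * \<delta> / \<zeta>))"
      using n R0 H0 Y Qw by (intro mult_left_mono add_mono) auto
    also have "\<dots> = \<theta> * (2 * \<delta> / (?n - 1)) * ?T (big_exp_deriv A ?w) + (q - 1) * ?H k E"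
      by (simp add: q_def distrib_left mult_ac)
    also have "\<dots> \<le> \<theta> * \<Delta> * ?T (big_exp_deriv A ?w) + (q - 1) * ?H (Suc k) E"
      using D2 th R0 q1 \<open>?H k E \<le> ?H (Suc k) E\<close> by (intro add_mono mult_right_mono mult_left_mono) auto
    finally have f: "?H k E + 2 / (?n - 1) * (?T (big_exp_deriv A ?w) * ?T (small_exp A ?w) + ?H k E * ?T (small_exp_deriv A ?w))
        \<le> q * ?H (Suc k) E"
      using HS by (simp add: algebra_simps)
    have "(\<Sum>e\<in>nsets V 2. min 1 (G k (insert e E))) / card (nsets V 2) \<le>
      c * (?H k E + real k * \<beta>
        + 2 * A * exp (- (z k - ?w) * A) / (?n - 1) * (?T (\<lambda>s. small_exp A (z k) s + of_bool (real s \<le> A)))\<^sup>2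
        + 2 / (?n - 1) * (?T (big_exp_deriv A ?w) * ?T (small_exp A ?w) + ?H k E * ?T (small_exp_deriv A ?w)))
      + ?n / (?n - 1) * (?T (\<lambda>s. of_bool (real s > A)))\<^sup>2"
      unfolding G_def c_def[symmetric] using w pos c0 b0 by (intro avg_min_big_le V) auto
    also have "\<dots> \<le> c * (q * ?H (Suc k) E + (real k + 1) * \<beta>) + \<kappa>"
    proof (rule add_mono[OF mult_left_mono[OF _ c0]])
      show "?n / (?n - 1) * (?T (\<lambda>s. of_bool (real s > A)))\<^sup>2 \<le> \<kappa>"
        unfolding \<kappa>_def using n B B0 by (intro mult_left_mono power_mono) auto
      have "(real k + 1) * \<beta> = real k * \<beta> + \<beta>" by (simp add: algebra_simps)
      with e f show "?H k E + real k * \<beta>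
        + 2 * A * exp (- (z k - ?w) * A) / (?n - 1) * (?T (\<lambda>s. small_exp A (z k) s + of_bool (real s \<le> A)))\<^sup>2
        + 2 / (?n - 1) * (?T (big_exp_deriv A ?w) * ?T (small_exp A ?w) + ?H k E * ?T (small_exp_deriv A ?w))
        \<le> q * ?H (Suc k) E + (real k + 1) * \<beta>"
        by linarith
    qed
    also have "c * (q * ?H (Suc k) E + (real k + 1) * \<beta>) \<le> c * (q * ?H (Suc k) E + q * ((real k + 1) * \<beta>))"
      using c0 q1 b0 mult_right_mono[of 1 q "(real k + 1) * \<beta>"] by (intro mult_left_mono add_left_mono) auto
    also have "\<dots> = G (Suc k) E" by (simp add: G_def c_def algebra_simps add_divide_distrib)
    finally have "(\<Sum>e\<in>nsets V 2. min 1 (G k (insert e E))) / card (nsets V 2) \<le> G (Suc k) E + \<kappa>" by simp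
    \<comment> \<open>The cap must survive the step: being at most 1 and at most
      \<open>G (Suc k) E + \<kappa>\<close>, the average is at most
      \<open>min 1 (G (Suc k) E) + \<kappa>\<close>.\<close>
    moreover have "(\<Sum>e\<in>nsets V 2. min 1 (G k (insert e E))) / card (nsets V 2) \<le> 1"
    proof -
      have "(\<Sum>e\<in>nsets V 2. min 1 (G k (insert e E))) \<le> (\<Sum>e\<in>nsets V 2. 1)" by (intro sum_mono) auto
      then show ?thesis by (intro divide_le_eq_1[THEN iffD2]) (auto simp del: card_nsets)
    qed
    ultimately have step2: "(\<Sum>e\<in>nsets V 2. min 1 (G k (insert e E))) / card (nsets V 2) \<le> min 1 (G (Suc k) E) + \<kappa>"
      using k0 by auto
    have cn: "card (nsets V 2) \<noteq> 0"
      using V by (simp add: nsets_eq_empty_iff finite_imp_finite_nsets del: card_nsets)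
    have "(\<Sum>e\<in>nsets V 2. \<Phi> k (insert e E)) / card (nsets V 2) =
        (\<Sum>e\<in>nsets V 2. exp (\<tau> * (?X k (insert e E) - \<delta>))) / card (nsets V 2)
        + (\<Sum>e\<in>nsets V 2. min 1 (G k (insert e E))) / card (nsets V 2) + real k * \<kappa>"
      using cn by (simp add: \<Phi>_def sum.distrib add_divide_distrib del: card_nsets)
    then show "(\<Sum>e\<in>nsets V 2. \<Phi> k (insert e E)) / card (nsets V 2) \<le> \<Phi> (Suc k) E"
      using step1 step2 by (simp add: \<Phi>_def algebra_simps del: card_nsets)
  qed
  also have "\<dots> \<le> exp (\<tau> * (?X m E - \<delta>)) + G m E + real m * \<kappa>"
    by (simp add: \<Phi>_def)
  finally show ?thesis by (simp add: bad_def G_def z_def)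
qed

section \<open>Passing between exponential moments, tails and susceptibility\<close>

text \<open>Convexity brings the small part to the exponent \<open>\<theta> * \<zeta>\<close> of the
  large part, giving a full moment of at most \<open>1 + \<theta> * \<delta> + h\<close>. Markov's
  inequality yields the tail. In the susceptibility \<open>\<theta>\<close> cancels from the main
  term, so the smaller exponent loses only in the term with \<open>h\<close>.\<close>

lemma good_state_conclusions:
  fixes V :: "'a set" and E :: "'a set set" and A \<zeta> \<theta> \<delta> h :: real
  assumes V: "finite V" "V \<noteq> {}" and z: "\<zeta> > 0" and th: "0 < \<theta>" "\<theta> \<le> 1"
    and small: "comp_avg V E (small_exp A \<zeta>) \<le> \<delta>" and big: "comp_avg V E (big_exp A (\<theta> * \<zeta>)) \<le> h"
  shows "susceptibility V E \<le> \<delta> / \<zeta> + h / (\<theta> * \<zeta>)"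
    and "component_tail (1 + \<theta> * \<delta> + h) (\<theta> * \<zeta>) V E"
proof -
  let ?T = "comp_avg V E" and ?w = "\<theta> * \<zeta>"
  have w: "?w > 0" using z th by simp
  have "?T (\<lambda>s. exp (?w * real s) - 1) \<le> ?T (\<lambda>s. \<theta> * small_exp A \<zeta> s + big_exp A ?w s)"
  proof (rule comp_avg_mono)
    fix v
    show "exp (?w * real (card (component V E v))) - 1 \<le>
      \<theta> * small_exp A \<zeta> (card (component V E v)) + big_exp A ?w (card (component V E v))"
      using small_exp_scale[of \<theta> A \<zeta> "card (component V E v)"] th
      by (simp add: small_exp_def big_exp_def split: if_splits)
  qed
  also have "\<dots> \<le> \<theta> * \<delta> + h"
    using small big th by (simp add: comp_avg_add comp_avg_cmult add_mono mult_left_mono)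
  finally have exp1: "?T (\<lambda>s. exp (?w * real s) - 1) \<le> \<theta> * \<delta> + h" .
  have "?w * susceptibility V E \<le> ?T (\<lambda>s. exp (?w * real s) - 1)"
    unfolding susceptibility_eq_comp_avg comp_avg_cmult[symmetric]
    using exp_ge_add_one_self by (intro comp_avg_mono) (simp add: le_diff_eq add.commute)
  with exp1 have "?w * susceptibility V E \<le> \<theta> * \<delta> + h" by linarith
  then have "susceptibility V E \<le> (\<theta> * \<delta> + h) / ?w" using w by (simp add: field_simps)
  then show "susceptibility V E \<le> \<delta> / \<zeta> + h / (\<theta> * \<zeta>)"
    using th by (simp add: add_divide_distrib)
  show "component_tail (1 + \<theta> * \<delta> + h) ?w V E"
    unfolding component_tail_def
  proof (intro allI impI)
    fix s :: nat
    have "exp (?w * real s) * ?T (\<lambda>t. of_bool (t \<ge> s)) \<le> ?T (\<lambda>t. exp (?w * real t))"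
      unfolding comp_avg_cmult[symmetric] using w by (intro comp_avg_mono) (auto simp: mult_left_mono)
    also have "\<dots> \<le> 1 + \<theta> * \<delta> + h"
      using exp1 by (simp add: comp_avg_diff comp_avg_const V)
    finally have "?T (\<lambda>t. of_bool (t \<ge> s)) \<le> (1 + \<theta> * \<delta> + h) * exp (- ?w * real s)"
      by (simp add: exp_minus field_simps)
    then show "real (card {v \<in> V. s \<le> card (component V E v)}) \<le> (1 + \<theta> * \<delta> + h) * exp (- ?w * real s) * real (card V)"
      using V by (simp add: comp_avg_indicator pos_divide_le_eq card_gt_0_iff)
  qed
qed

text \<open>Half of the tail rate is given up, so that the sum over the possible orders becomes
  geometric with ratio \<open>exp (- c / 2)\<close>.\<close>

lemma tail_exp_moment:
  assumes "finite V" "component_tail K c V E" "K > 0" "c > 0"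
  shows "comp_avg V E (\<lambda>s. exp (c / 2 * real s)) \<le> K / (1 - exp (- c / 2))"
proof (cases "V = {}")
  case True
  then show ?thesis using assms by (simp add: comp_avg_def)
next
  case False
  note fin = assms(1)
  let ?n = "card V" and ?C = "\<lambda>v. card (component V E v)" and ?r = "exp (- c / 2)"
  have Cn: "?C v \<le> ?n" for v using fin component_subset by (metis card_mono)
  have "(\<Sum>v\<in>V. exp (c / 2 * real (?C v))) = (\<Sum>v\<in>V. \<Sum>s\<in>{1..?n}. of_bool (?C v = s) * exp (c / 2 * real s))"
  proof (rule sum.cong)
    fix v assume "v \<in> V"
    then have "?C v \<in> {1..?n}" using card_component_pos[OF fin] Cn by simp
    then have "(\<Sum>s\<in>{1..?n}. of_bool (?C v = s) * exp (c / 2 * real s)) =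
        (\<Sum>s\<in>{1..?n}. if s = ?C v then exp (c / 2 * real (?C v)) else 0)"
      by (intro sum.cong) auto
    with \<open>?C v \<in> {1..?n}\<close> show "exp (c / 2 * real (?C v)) = (\<Sum>s\<in>{1..?n}. of_bool (?C v = s) * exp (c / 2 * real s))"
      by simp
  qed simp
  also have "\<dots> = (\<Sum>s\<in>{1..?n}. (\<Sum>v\<in>V. of_bool (?C v = s)) * exp (c / 2 * real s))"
    by (subst sum.swap) (simp add: sum_distrib_right)
  also have "\<dots> \<le> (\<Sum>s\<in>{1..?n}. K * real ?n * ?r ^ s)"
  proof (rule sum_mono)
    fix s assume s: "s \<in> {1..?n}"
    have "(\<Sum>v\<in>V. of_bool (?C v = s)) \<le> (\<Sum>v\<in>V. of_bool (?C v \<ge> s) :: real)"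
      by (intro sum_mono) auto
    also have "\<dots> = real (card {v \<in> V. ?C v \<ge> s})"
      using fin by (simp add: of_bool_def sum.If_cases Int_def)
    also have "\<dots> \<le> K * exp (- c * real s) * real ?n"
      using assms(2) s by (simp add: component_tail_def)
    finally have "(\<Sum>v\<in>V. of_bool (?C v = s)) * exp (c / 2 * real s) \<le>
        K * exp (- c * real s) * real ?n * exp (c / 2 * real s)" by (intro mult_right_mono) auto
    also have "\<dots> = K * real ?n * ?r ^ s"
      by (simp add: exp_of_nat_mult[symmetric] field_simps flip: exp_add)
    finally show "(\<Sum>v\<in>V. of_bool (?C v = s)) * exp (c / 2 * real s) \<le> K * real ?n * ?r ^ s" .
  qed
  also have "\<dots> = K * real ?n * (\<Sum>s\<in>{1..?n}. ?r ^ s)" by (simp add: sum_distrib_left)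
  also have "(\<Sum>s\<in>{1..?n}. ?r ^ s) \<le> (\<Sum>s. ?r ^ s)"
    using assms by (intro sum_le_suminf summable_geometric) auto
  also have "(\<Sum>s. ?r ^ s) = 1 / (1 - ?r)" using assms by (intro suminf_geometric) auto
  finally show ?thesis using assms False fin
    by (simp add: comp_avg_def pos_divide_le_eq card_gt_0_iff mult_left_mono)
qed

text \<open>Using \<open>exp x - 1 \<le> x * exp x\<close> twice leaves a remainder of at most
  \<open>x\<^sup>2 * exp x\<close>. The constant \<open>64 / c\<^sup>2\<close> comes from squaring
  \<open>c * s / 8 \<le> exp (c * s / 8)\<close>; the factors \<open>s\<^sup>2\<close> and
  \<open>exp (z * s)\<close> each take \<open>c / 4\<close> of the exponent.\<close>

lemma exp_minus_one_le_quadratic: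
  fixes c :: real
  assumes "c > 0"
  shows "\<exists>B>0. \<forall>z s. 0 \<le> z \<longrightarrow> z \<le> c / 4 \<longrightarrow> 0 \<le> s \<longrightarrow> exp (z * s) - 1 \<le> z * s + B * z\<^sup>2 * exp (c / 2 * s)"
proof (intro exI conjI allI impI)
  show "64 / c\<^sup>2 > 0" using assms by simp
  fix z s :: real
  assume z: "0 \<le> z" "z \<le> c / 4" and s: "0 \<le> s"
  have "c * s / 8 \<le> exp (c * s / 8)" using exp_ge_add_one_self[of "c * s / 8"] by linarith
  then have "(c * s / 8)\<^sup>2 \<le> (exp (c * s / 8))\<^sup>2" using assms s by (intro power_mono) auto
  then have "(c * s / 8)\<^sup>2 \<le> exp (c / 4 * s)" by (simp add: power2_eq_square flip: exp_add)
  then have s2: "s\<^sup>2 \<le> 64 / c\<^sup>2 * exp (c / 4 * s)" using assms by (simp add: field_simps power2_eq_square)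
  let ?x = "z * s"
  have x: "?x \<ge> 0" "?x \<le> c / 4 * s" using z s mult_right_mono[OF z(2) s] by auto
  have "exp ?x * (1 - ?x) \<le> exp ?x * exp (- ?x)"
    using exp_ge_add_one_self[of "- ?x"] by (intro mult_left_mono) auto
  then have e: "exp ?x - 1 \<le> ?x * exp ?x" by (simp add: algebra_simps flip: exp_add)
  have "exp ?x - 1 - ?x \<le> ?x * (exp ?x - 1)" using e by (simp add: algebra_simps)
  also have "\<dots> \<le> ?x * (?x * exp ?x)" using e x by (intro mult_left_mono) auto
  also have "\<dots> = z\<^sup>2 * (s\<^sup>2 * exp ?x)" by (simp add: power2_eq_square)
  also have "\<dots> \<le> z\<^sup>2 * ((64 / c\<^sup>2 * exp (c / 4 * s)) * exp (c / 4 * s))"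
    using s2 x by (intro mult_left_mono mult_mono) auto
  also have "\<dots> = 64 / c\<^sup>2 * z\<^sup>2 * exp (c / 2 * s)" by (simp flip: exp_add)
  finally show "exp ?x - 1 \<le> ?x + 64 / c\<^sup>2 * z\<^sup>2 * exp (c / 2 * s)" by linarith
qed

text \<open>Expansion at \<open>z = 0\<close>, where the slope is the susceptibility.
  \<open>B\<close> precedes the graph in the quantifiers, hence depends on \<open>K\<close> and
  \<open>c\<close> only.\<close>

lemma tail_exp_moment_expansion:
  assumes "K > 0" "c > 0"
  shows "\<exists>B>0. \<forall>(V :: 'a set) E z. finite V \<longrightarrow> component_tail K c V E \<longrightarrow> 0 \<le> z \<longrightarrow> z \<le> c / 4 \<longrightarrow>
    comp_avg V E (\<lambda>s. exp (z * real s) - 1) \<le> z * susceptibility V E + B * z\<^sup>2"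
proof -
  obtain B where B: "B > 0" and Bq: "\<And>z s. 0 \<le> z \<Longrightarrow> z \<le> c / 4 \<Longrightarrow> 0 \<le> s \<Longrightarrow>
      exp (z * s) - 1 \<le> z * s + B * z\<^sup>2 * exp (c / 2 * s)"
    using exp_minus_one_le_quadratic[OF assms(2)] by blast
  define M where "M = K / (1 - exp (- c / 2))"
  have M: "M > 0" using assms by (simp add: M_def)
  show ?thesis
  proof (intro exI conjI allI impI)
    show "B * M > 0" using B M by simp
    fix V :: "'a set" and E z
    assume VE: "finite V" "component_tail K c V E" and z: "0 \<le> z" "z \<le> c / 4"
    have "comp_avg V E (\<lambda>s. exp (z * real s) - 1) \<le>
        comp_avg V E (\<lambda>s. z * real s + B * z\<^sup>2 * exp (c / 2 * real s))"
      using Bq[OF z] by (intro comp_avg_mono) auto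
    also have "\<dots> = z * susceptibility V E + B * z\<^sup>2 * comp_avg V E (\<lambda>s. exp (c / 2 * real s))"
      by (simp only: comp_avg_add comp_avg_cmult susceptibility_eq_comp_avg)
    also have "\<dots> \<le> z * susceptibility V E + B * z\<^sup>2 * M"
      using tail_exp_moment[OF VE assms] B unfolding M_def by (intro add_left_mono mult_left_mono) auto
    finally show "comp_avg V E (\<lambda>s. exp (z * real s) - 1) \<le> z * susceptibility V E + B * M * z\<^sup>2"
      by (simp add: mult_ac)
  qed
qed

section \<open>Good states and the asymptotics of one round\<close>

definition good_state :: "real \<Rightarrow> real \<Rightarrow> real \<Rightarrow> nat \<Rightarrow> nat set set \<Rightarrow> bool" where
  "good_state K c b n E \<longleftrightarrow> component_tail K c {..<n} E \<and> susceptibility {..<n} E \<le> b"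

text \<open>The summand 1 absorbs the rounding when a number of edges is split into two rounds.\<close>

definition step_bound :: "real \<Rightarrow> real \<Rightarrow> real \<Rightarrow> real \<Rightarrow> real \<Rightarrow> real \<Rightarrow> real \<Rightarrow> bool" where
  "step_bound \<mu> K c a K' c' b \<longleftrightarrow> (\<forall>\<eta>>0. \<forall>\<^sub>F n in sequentially. \<forall>m E.
    real m \<le> \<mu> * real n + 1 \<longrightarrow> good_state K c a n E \<longrightarrow>
    measure_pmf.prob (add_random_edges {..<n} E m) {E'. good_state K' c' b n E'} \<ge> 1 - \<eta>)"

text \<open>Here \<open>x\<close> and \<open>y\<close> are lower bounds for the reciprocal of the susceptibility, which decreases
  on average by at most about \<open>2 / n\<close> per edge.\<close>

definition good_step :: "real \<Rightarrow> real \<Rightarrow> real \<Rightarrow> bool" where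
  "good_step x \<mu> y \<longleftrightarrow> (\<forall>K>0. \<forall>c>0. \<exists>K'>0. \<exists>c'>0. step_bound \<mu> K c (1 / x) K' c' (1 / y))"

lemma pmf_prob_ge_if_complement:
  assumes "measure_pmf.prob p B \<le> r" "\<And>x. x \<notin> B \<Longrightarrow> x \<in> A"
  shows "measure_pmf.prob p A \<ge> 1 - r"
proof -
  have "1 - measure_pmf.prob p B = measure_pmf.prob p (- B)"
    using measure_pmf.prob_compl[of B p] by (simp add: Compl_eq_Diff_UNIV)
  also have "\<dots> \<le> measure_pmf.prob p A"
    using assms(2) by (intro measure_pmf.finite_measure_mono) auto
  finally show ?thesis using assms(1) by linarith
qed

lemma component_tail_mono:
  assumes "component_tail K c V E" "K \<le> K'" "c' \<le> c" "K' \<ge> 0"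
  shows "component_tail K' c' V E"
  unfolding component_tail_def
proof (intro allI impI)
  fix s :: nat assume "s \<ge> 1"
  then have "real (card {v \<in> V. s \<le> card (component V E v)}) \<le> K * exp (- c * real s) * real (card V)"
    using assms(1) by (simp add: component_tail_def)
  also have "\<dots> \<le> K' * exp (- c' * real s) * real (card V)"
    using assms by (intro mult_right_mono mult_mono) (auto simp: mult_right_mono)
  finally show "real (card {v \<in> V. s \<le> card (component V E v)}) \<le> K' * exp (- c' * real s) * real (card V)" .
qed

text \<open>A round spends three factors \<open>\<rho>\<close>: on the initial moment, on the
  second-order term of the jumps, and on the ratio of edges to \<open>n - 1\<close>.\<close>

lemma cube_slack:
  fixes r :: real
  assumes "r > 1"
  obtains \<rho> where "\<rho> > 1" "\<rho> ^ 3 < r" "\<rho> ^ 3 \<le> 2"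
proof -
  define t where "t = (min r 2 - 1) / 8"
  have t: "0 < t" "t \<le> 1 / 8" "1 + 8 * t = min r 2"
    using assms unfolding t_def by (auto simp: min_def field_simps)
  have "t * t \<le> t * 1" "t * (t * t) \<le> t * 1" using t by (auto intro!: mult_left_mono mult_le_one)
  then have "(1 + t) ^ 3 \<le> 1 + 7 * t"
    by (simp add: power3_eq_cube algebra_simps)
  then show ?thesis using that[of "1 + t"] t by (simp add: min_def split: if_splits)
qed

lemma big_exp_le:
  assumes "0 \<le> \<theta>" "\<theta> \<le> 1" "z \<ge> 0"
  shows "big_exp A (\<theta> * z) s \<le> exp (- ((1 - \<theta>) * z * A)) * exp (z * real s)"
proof (cases "real s \<le> A")
  case False
  then have "(1 - \<theta>) * z * A \<le> (1 - \<theta>) * z * real s" using assms by (intro mult_left_mono) auto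
  then show ?thesis using False by (simp add: big_exp_def algebra_simps flip: exp_add)
qed (simp add: big_exp_def)

text \<open>The level \<open>\<delta>\<close> is about \<open>z / x\<close> and the exponent falls
  by about \<open>2 * \<delta> / n\<close> per edge, so the final ratio of exponent to level is
  about \<open>x - 2 * \<mu>\<close>, which exceeds \<open>y\<close>. The last hypothesis keeps the
  exponent above nine tenths of \<open>z\<close>, as the powers of \<open>n\<close> require.\<close>

lemma good_step_small:
  assumes "y > 0" "\<mu> > 0" "y + 2 * \<mu> < x" "2 * \<mu> \<le> x / 40"
  shows "good_step x \<mu> y"
  unfolding good_step_def
proof (intro allI impI)
  fix K c :: real assume Kc: "K > 0" "c > 0"
  have x: "x > 0" using assms by linarith
  obtain \<rho> where rho: "\<rho> > 1" "\<rho> ^ 3 < x / (y + 2 * \<mu>)" "\<rho> ^ 3 \<le> 2"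
    using cube_slack[of "x / (y + 2 * \<mu>)"] assms by auto
  have rho1: "\<rho> \<le> \<rho> ^ 3" using power_increasing[of 1 3 \<rho>] rho by simp
  obtain B where B: "B > 0" and expand: "\<And>(V :: nat set) E z. finite V \<Longrightarrow> component_tail K c V E \<Longrightarrow>
      0 \<le> z \<Longrightarrow> z \<le> c / 4 \<Longrightarrow> comp_avg V E (\<lambda>s. exp (z * real s) - 1) \<le> z * susceptibility V E + B * z\<^sup>2"
    using tail_exp_moment_expansion[OF Kc] by metis
  \<comment> \<open>Small enough that the quadratic error uses at most half of the gap between
    \<open>z / x\<close> and \<open>\<delta> = \<rho> * z / x\<close>. The other half is the margin
    \<open>\<epsilon>\<close> for the concentration bound.\<close>
  define z where "z = min (c / 4) ((\<rho> - 1) / (2 * B * x))"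
  have z: "z > 0" "z \<le> c / 4" using Kc rho B x by (auto simp: z_def)
  have "z \<le> (\<rho> - 1) / (2 * B * x)" by (simp add: z_def)
  then have "B * z \<le> (\<rho> - 1) / (2 * x)" using B x by (simp add: field_simps)
  then have "B * z * z \<le> (\<rho> - 1) / (2 * x) * z" using z by (intro mult_right_mono) auto
  then have Bz: "B * z\<^sup>2 \<le> (\<rho> - 1) / (2 * x) * z" by (simp add: power2_eq_square mult.assoc)
  define \<delta> where "\<delta> = \<rho> * z / x"
  define \<epsilon> where "\<epsilon> = (\<rho> - 1) / (2 * x) * z"
  have \<delta>: "\<delta> > 0" "\<epsilon> > 0" using rho z x by (auto simp: \<delta>_def \<epsilon>_def)
  have init: "comp_avg V E (\<lambda>s. exp (z * real s) - 1) \<le> \<delta> - \<epsilon>"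
    if "finite V" "component_tail K c V E" "susceptibility V E \<le> 1 / x" for V :: "nat set" and E
  proof -
    have "comp_avg V E (\<lambda>s. exp (z * real s) - 1) \<le> z * susceptibility V E + B * z\<^sup>2"
      using expand[OF that(1,2)] z by simp
    also have "\<dots> \<le> z * (1 / x) + (\<rho> - 1) / (2 * x) * z"
      using Bz that(3) z by (intro add_mono mult_left_mono) auto
    also have "\<dots> = \<delta> - \<epsilon>" using x by (simp add: \<delta>_def \<epsilon>_def field_simps)
    finally show ?thesis .
  qed
  define \<zeta>0 where "\<zeta>0 = z * (1 - 2 * \<rho> ^ 3 * \<mu> / x)"
  have "2 * \<rho> ^ 3 * \<mu> / x \<le> 2 * 2 * \<mu> / x" using rho assms x by (intro divide_right_mono mult_right_mono) auto
  also have "\<dots> \<le> 1 / 10" using assms x by (simp add: field_simps)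
  finally have "\<zeta>0 \<ge> z * (9 / 10)" unfolding \<zeta>0_def using z by (intro mult_left_mono) auto
  then have \<zeta>0: "\<zeta>0 \<ge> 9 / 10 * z" "\<zeta>0 > 0" using z by auto
  have S: "\<delta> / \<zeta>0 < 1 / y"
  proof -
    have "\<rho> * y + 2 * \<rho> ^ 3 * \<mu> \<le> \<rho> ^ 3 * (y + 2 * \<mu>)"
      using mult_right_mono[OF rho1, of y] assms by (simp add: algebra_simps)
    also have "\<dots> < x" using rho assms by (simp add: pos_less_divide_eq)
    finally have "\<rho> * y < x - 2 * \<rho> ^ 3 * \<mu>" by simp
    moreover have "\<delta> * y = z / x * (\<rho> * y)" "\<zeta>0 = z / x * (x - 2 * \<rho> ^ 3 * \<mu>)"
      using x by (simp_all add: \<delta>_def \<zeta>0_def field_simps)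
    ultimately have "\<delta> * y < \<zeta>0" using z x by (simp add: divide_strict_right_mono)
    then show ?thesis using \<zeta>0 assms by (simp add: field_simps)
  qed
  (* The cutoff has exp (z * A) = n^(9/10), so jumps times \<tau> vanish. Large components arise with
     probability of order n^-((9/10)^3), which is far below h = n^(-3/5), and n * h^2 vanishes. *)
  define A where "A = (\<lambda>n::nat. 9 / 10 * ln (real n) / z)"
  define h where "h = (\<lambda>n::nat. exp (- (3 / 5) * ln (real n)))"
  define \<tau> where "\<tau> = (\<lambda>n::nat. exp (1 / 20 * ln (real n)))"
  define Q where "Q = exp (4 * \<delta> * (\<rho> * \<mu>) / \<zeta>0)"
  \<comment> \<open>The summands follow \<open>final_state_bound\<close> with
    \<open>\<theta> = 1 / 10\<close>. Large components present at the start give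
    \<open>81 / 100 = 9 / 10 * (9 / 10)\<close>; for those created later the exponent may have
    dropped to nine tenths, which adds one more factor \<open>9 / 10\<close>.\<close>
  define R where "R = (\<lambda>n::nat. exp (- (\<epsilon> * exp (1 / 20 * ln (real n))))
    + Q * (exp (- (81 / 100) * ln (real n)) * (1 + \<delta>)
        + \<rho> * \<mu> * (2 * (9 / 10 * ln (real n) / z) * exp (- (729 / 1000) * ln (real n)) * (1 + \<delta>)\<^sup>2)) / exp (- (3 / 5) * ln (real n))
    + \<rho> * \<mu> * (real n * (exp (- (3 / 5) * ln (real n)))\<^sup>2))"
  show "\<exists>K'>0. \<exists>c'>0. step_bound \<mu> K c (1 / x) K' c' (1 / y)"
    unfolding step_bound_def
  \<comment> \<open>The constants of \<open>good_state_conclusions\<close> made independent of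
    \<open>n\<close>, using \<open>h n \<le> 1\<close> and
    \<open>\<zeta> \<ge> \<zeta>0\<close>.\<close>
  proof (rule exI[of _ "2 + \<delta>"], intro conjI, goal_cases)
    case 2
    show ?case
    proof (rule exI[of _ "1 / 10 * \<zeta>0"], intro conjI allI impI)
      fix \<eta> :: real assume "\<eta> > 0"
      have "R \<longlonglongrightarrow> 0" unfolding R_def using \<delta>(2) z(1) by real_asymp
      then have e1: "\<forall>\<^sub>F n in sequentially. R n < \<eta>" using \<open>\<eta> > 0\<close> order_tendstoD(2) by blast
      have "(\<lambda>n. exp (1 / 20 * ln (real n)) * (9 / 10 * ln (real n) / z * exp (9 / 10 * ln (real n))) / real n) \<longlonglongrightarrow> 0"
        using z(1) by real_asymp
      then have e2: "\<forall>\<^sub>F n in sequentially. exp (1 / 20 * ln (real n)) * (9 / 10 * ln (real n) / z * exp (9 / 10 * ln (real n))) / real n < \<rho> - 1"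
        using rho order_tendstoD(2) by force
      have "(\<lambda>n. (\<mu> * real n + 1) / (real n - 1)) \<longlonglongrightarrow> \<mu>" by real_asymp
      moreover have "\<mu> < \<rho> * \<mu>" using assms rho by simp
      ultimately have e3: "\<forall>\<^sub>F n in sequentially. (\<mu> * real n + 1) / (real n - 1) < \<rho> * \<mu>"
        using order_tendstoD(2) by blast
      have "(\<lambda>n. \<delta> / \<zeta>0 + exp (- (3 / 5) * ln (real n)) / (1 / 10 * \<zeta>0)) \<longlonglongrightarrow> \<delta> / \<zeta>0"
        using \<zeta>0(2) by real_asymp
      then have e4: "\<forall>\<^sub>F n in sequentially. \<delta> / \<zeta>0 + exp (- (3 / 5) * ln (real n)) / (1 / 10 * \<zeta>0) < 1 / y"
        using S order_tendstoD(2) by blast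
      show "\<forall>\<^sub>F n in sequentially. \<forall>m E. real m \<le> \<mu> * real n + 1 \<longrightarrow> good_state K c (1 / x) n E \<longrightarrow>
        measure_pmf.prob (add_random_edges {..<n} E m) {E'. good_state (2 + \<delta>) (1 / 10 * \<zeta>0) (1 / y) n E'} \<ge> 1 - \<eta>"
        using e1 e2 e3 e4 eventually_ge_at_top[of 2]
      proof eventually_elim
        case (elim n)
        show ?case
        proof (intro allI impI)
          fix m and E :: "nat set set"
          assume m: "real m \<le> \<mu> * real n + 1" and "good_state K c (1 / x) n E"
          then have VE: "component_tail K c {..<n} E" "susceptibility {..<n} E \<le> 1 / x"
            by (simp_all add: good_state_def)
          define \<Delta> where "\<Delta> = 2 * \<delta> * \<rho> / (real n - 1)"
          \<comment> \<open>\<open>final_state_bound\<close> is stated from the final exponent, so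
            this one is chosen to make the starting exponent exactly \<open>z\<close>.\<close>
          define \<zeta> where "\<zeta> = z - real m * \<Delta>"
          have n: "real n \<ge> 2" using elim by simp
          have lnn: "ln (real n) > 0" using n by simp
          have A: "A n > 0" using lnn z by (simp add: A_def)
          have zA: "z * A n = 9 / 10 * ln (real n)" using z by (simp add: A_def)
          have h: "h n > 0" "h n \<le> 1" using lnn by (simp_all add: h_def)
          have "real m / (real n - 1) \<le> (\<mu> * real n + 1) / (real n - 1)"
            using m n by (intro divide_right_mono) auto
          then have mn: "real m / (real n - 1) \<le> \<rho> * \<mu>" using elim by linarith
          have "real m * \<Delta> = 2 * \<delta> * \<rho> * (real m / (real n - 1))" by (simp add: \<Delta>_def)
          also have "\<dots> \<le> 2 * \<delta> * \<rho> * (\<rho> * \<mu>)" using mn \<delta> rho by (intro mult_left_mono) auto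
          also have "\<dots> = z * (2 * \<rho> ^ 3 * \<mu> / x)" by (simp add: \<delta>_def power3_eq_cube)
          finally have \<zeta>: "\<zeta> \<ge> \<zeta>0" by (simp add: \<zeta>_def \<zeta>0_def algebra_simps)
          then have \<zeta>pos: "\<zeta> > 0" using \<zeta>0 by linarith
          let ?V = "{..<n}"
          let ?bad = "{E'. comp_avg ?V E' (small_exp (A n) \<zeta>) > \<delta> \<or> comp_avg ?V E' (big_exp (A n) (1 / 10 * \<zeta>)) > h n}"
          have V: "finite ?V" "card ?V \<ge> 2" "?V \<noteq> {}" using elim by (auto simp: lessThan_empty_iff)
          define H where "H = comp_avg ?V E (big_exp (A n) (1 / 10 * z))"
          define X where "X = comp_avg ?V E (small_exp (A n) z)"
          define q where "q = 1 + 4 * \<delta> / (\<zeta> * (real n - 1))"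
          define \<beta> where "\<beta> = 2 * A n * exp (- (1 - 1 / 10) * \<zeta> * A n) / (real n - 1) * (1 + \<delta>)\<^sup>2"
          define \<kappa> where "\<kappa> = real n / (real n - 1) * (h n)\<^sup>2"
          have "measure_pmf.prob (add_random_edges ?V E m) ?bad \<le>
              exp (\<tau> n * (X - \<delta>)) + q ^ m * (H + real m * \<beta>) / h n + real m * \<kappa>"
          proof -
            have j: "\<tau> n * (A n * exp ((\<zeta> + real m * \<Delta>) * A n)) / real (card ?V) \<le> \<rho> - 1"
              using elim(2) by (simp add: \<zeta>_def zA) (simp add: \<tau>_def A_def)
            have D: "\<Delta> \<ge> 2 * \<delta> * (1 + (\<rho> - 1)) / (real (card ?V) - 1)" by (simp add: \<Delta>_def)
            show ?thesis
              using final_state_bound[OF V(1,2) A \<zeta>pos \<delta>(1) h(1) _ _ _ _ _ D j, of "1 / 10" E] rho rho1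
              by (simp add: X_def H_def q_def \<beta>_def \<kappa>_def \<zeta>_def \<tau>_def)
          qed
          also have "\<dots> \<le> R n"
          proof -
            have i: "comp_avg ?V E (\<lambda>s. exp (z * real s) - 1) \<le> \<delta> - \<epsilon>" using init[OF V(1) VE] .
            have "X \<le> comp_avg ?V E (\<lambda>s. exp (z * real s) - 1)"
              unfolding X_def using z by (intro comp_avg_mono) (auto simp: small_exp_def)
            \<comment> \<open>The margin \<open>\<epsilon>\<close> is multiplied by
              \<open>\<tau> n\<close>, a positive power of \<open>n\<close>, so the first error term
              vanishes.\<close>
            with i have "\<tau> n * (X - \<delta>) \<le> \<tau> n * (- \<epsilon>)" by (intro mult_left_mono) (auto simp: \<tau>_def)
            then have r1: "exp (\<tau> n * (X - \<delta>)) \<le> exp (- (\<epsilon> * exp (1 / 20 * ln (real n))))"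
              by (simp add: \<tau>_def mult.commute)
            have "H \<le> comp_avg ?V E (\<lambda>s. exp (- ((1 - 1 / 10) * z * A n)) * exp (z * real s))"
              unfolding H_def using z by (intro comp_avg_mono big_exp_le) auto
            also have "\<dots> = exp (- ((1 - 1 / 10) * z * A n)) * comp_avg ?V E (\<lambda>s. exp (z * real s))"
              by (rule comp_avg_cmult)
            also have "\<dots> \<le> exp (- ((1 - 1 / 10) * z * A n)) * (1 + \<delta>)"
              using i \<delta> by (intro mult_left_mono) (auto simp: comp_avg_diff comp_avg_const V)
            also have "(1 - 1 / 10) * z * A n = 81 / 100 * ln (real n)"
              using zA by (simp only: mult.assoc) simp
            finally have r2: "H \<le> exp (- (81 / 100) * ln (real n)) * (1 + \<delta>)" by simp
            have "9 / 10 * z \<le> \<zeta>" using \<zeta> \<zeta>0 by linarith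
            then have "9 / 10 * z * A n \<le> \<zeta> * A n" using A by (intro mult_right_mono) auto
            then have "9 / 10 * (9 / 10 * ln (real n)) \<le> \<zeta> * A n" using zA by (simp only: mult.assoc)
            then have eA: "exp (- (1 - 1 / 10) * \<zeta> * A n) \<le> exp (- (729 / 1000) * ln (real n))" by simp
            have "real m * \<beta> = real m / (real n - 1) * (2 * A n * exp (- (1 - 1 / 10) * \<zeta> * A n) * (1 + \<delta>)\<^sup>2)"
              by (simp add: \<beta>_def)
            also have "\<dots> \<le> \<rho> * \<mu> * (2 * A n * exp (- (729 / 1000) * ln (real n)) * (1 + \<delta>)\<^sup>2)"
              using mn eA A rho assms by (intro mult_mono mult_right_mono mult_left_mono) auto
            finally have r3: "real m * \<beta> \<le> \<rho> * \<mu> * (2 * (9 / 10 * ln (real n) / z) * exp (- (729 / 1000) * ln (real n)) * (1 + \<delta>)\<^sup>2)"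
              by (simp add: A_def)
            have q0: "q \<ge> 1" using \<delta> \<zeta>pos n by (simp add: q_def)
            \<comment> \<open>The excess of \<open>q\<close> over 1 is of order
              \<open>1 / n\<close>, so over \<open>m\<close> edges the growth stays below the
              constant \<open>Q\<close>.\<close>
            have "q \<le> exp (4 * \<delta> / (\<zeta> * (real n - 1)))" unfolding q_def by (rule exp_ge_add_one_self)
            then have "q ^ m \<le> exp (4 * \<delta> / (\<zeta> * (real n - 1))) ^ m" using q0 by (intro power_mono) auto
            also have "\<dots> = exp (4 * \<delta> * (real m / (real n - 1)) / \<zeta>)"
              by (simp add: mult_ac flip: exp_of_nat_mult)
            also have "\<dots> \<le> Q" unfolding Q_def
              using mn \<zeta> \<zeta>0 \<delta> assms rho n by (subst exp_le_cancel_iff, intro frac_le mult_left_mono) auto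
            finally have r4: "q ^ m \<le> Q" .
            have H0: "H \<ge> 0" unfolding H_def by (intro comp_avg_nonneg) auto
            have b0: "\<beta> \<ge> 0" using A n by (simp add: \<beta>_def)
            have "q ^ m * (H + real m * \<beta>) / h n \<le>
              Q * (exp (- (81 / 100) * ln (real n)) * (1 + \<delta>)
                + \<rho> * \<mu> * (2 * (9 / 10 * ln (real n) / z) * exp (- (729 / 1000) * ln (real n)) * (1 + \<delta>)\<^sup>2)) / h n"
              by (intro divide_right_mono mult_mono add_mono[OF r2 r3] r4 add_nonneg_nonneg H0)
                 (use b0 h in \<open>auto simp: Q_def\<close>)
            moreover have "real m * \<kappa> \<le> \<rho> * \<mu> * (real n * (h n)\<^sup>2)"
              using mult_right_mono[OF mn, of "real n * (h n)\<^sup>2"] by (simp add: \<kappa>_def)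
            ultimately show ?thesis using r1 unfolding R_def h_def by linarith
          qed
          finally have "measure_pmf.prob (add_random_edges ?V E m) ?bad \<le> \<eta>" using elim by linarith
          then show "measure_pmf.prob (add_random_edges ?V E m)
            {E'. good_state (2 + \<delta>) (1 / 10 * \<zeta>0) (1 / y) n E'} \<ge> 1 - \<eta>"
          proof (rule pmf_prob_ge_if_complement)
            fix E' assume "E' \<notin> ?bad"
            then have g: "comp_avg ?V E' (small_exp (A n) \<zeta>) \<le> \<delta>" "comp_avg ?V E' (big_exp (A n) (1 / 10 * \<zeta>)) \<le> h n"
              by auto
            note c = good_state_conclusions[OF V(1,3) \<zeta>pos _ _ g]
            have "component_tail (1 + 1 / 10 * \<delta> + h n) (1 / 10 * \<zeta>) ?V E'" by (rule c(2)) auto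
            then have "component_tail (2 + \<delta>) (1 / 10 * \<zeta>0) ?V E'"
              by (rule component_tail_mono) (use h \<delta> \<zeta> in auto)
            moreover have "susceptibility ?V E' \<le> \<delta> / \<zeta> + h n / (1 / 10 * \<zeta>)" by (rule c(1)) auto
            moreover have "\<dots> \<le> \<delta> / \<zeta>0 + h n / (1 / 10 * \<zeta>0)"
              using \<zeta> \<zeta>0 \<delta> h by (intro add_mono divide_left_mono) auto
            moreover have "\<dots> < 1 / y" using elim by (simp only: h_def)
            ultimately show "E' \<in> {E'. good_state (2 + \<delta>) (1 / 10 * \<zeta>0) (1 / y) n E'}"
              by (simp add: good_state_def)
          qed
        qed
      qed
    qed (use \<zeta>0 in auto)
  qed (use \<delta> in auto)
qed

section \<open>Composing rounds\<close>

text \<open>\<open>step_bound\<close> is uniform over all good states, so the second round applies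
  to every good outcome of the first; each round may fail with probability
  \<open>\<eta> / 2\<close>.\<close>

lemma step_bound_trans:
  assumes s1: "step_bound \<mu>1 K c a K1 c1 a1" and s2: "step_bound \<mu>2 K1 c1 a1 K2 c2 b"
    and \<mu>: "\<mu>1 \<ge> 0" "\<mu>2 \<ge> 0"
  shows "step_bound (\<mu>1 + \<mu>2) K c a K2 c2 b"
  unfolding step_bound_def
proof (intro allI impI)
  fix \<eta> :: real assume "\<eta> > 0"
  then have \<eta>2: "\<eta> / 2 > 0" by simp
  show "\<forall>\<^sub>F n in sequentially. \<forall>m E. real m \<le> (\<mu>1 + \<mu>2) * real n + 1 \<longrightarrow> good_state K c a n E \<longrightarrow>
      measure_pmf.prob (add_random_edges {..<n} E m) {E'. good_state K2 c2 b n E'} \<ge> 1 - \<eta>"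
  \<comment> \<open>For \<open>\<eta> \<ge> 1\<close> the claim is void; otherwise
    \<open>1 - \<eta> / 2\<close> is positive, as multiplying the two bounds requires.\<close>
  proof (cases "\<eta> < 1")
    case False
    have "1 - \<eta> \<le> measure_pmf.prob p S" for p and S :: "nat set set set"
      using False measure_nonneg[of p S] by linarith
    then show ?thesis by simp
  next
    case True
    show ?thesis using s1[unfolded step_bound_def, rule_format, OF \<eta>2] s2[unfolded step_bound_def, rule_format, OF \<eta>2]
    proof eventually_elim
      case (elim n)
      show ?case
      proof (intro allI impI)
        fix m and E :: "nat set set"
        assume m: "real m \<le> (\<mu>1 + \<mu>2) * real n + 1" and E: "good_state K c a n E"
        \<comment> \<open>If \<open>m\<close> is small, the second round gets no edges. Otherwise
          rounding up leaves it at most \<open>\<mu>2 * real n + 1\<close>.\<close>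
        define m1 where "m1 = min m (nat \<lceil>\<mu>1 * real n\<rceil>)"
        define m2 where "m2 = m - m1"
        have "\<mu>1 * real n \<ge> 0" using \<mu> by simp
        then have cl: "\<mu>1 * real n \<le> real (nat \<lceil>\<mu>1 * real n\<rceil>)" "real (nat \<lceil>\<mu>1 * real n\<rceil>) \<le> \<mu>1 * real n + 1"
          by linarith+
        have mm: "m = m1 + m2" by (simp add: m2_def m1_def)
        have m1: "real m1 \<le> \<mu>1 * real n + 1" using cl by (simp add: m1_def min_def)
        have m2: "real m2 \<le> \<mu>2 * real n + 1"
        proof (cases "m1 = m")
          case True
          then show ?thesis using \<mu> by (simp add: m2_def)
        next
          case False
          then have "real m1 \<ge> \<mu>1 * real n" using cl by (simp add: m1_def min_def split: if_splits)
          moreover have "real m = real m1 + real m2" using mm by simp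
          ultimately show ?thesis using m by (simp add: distrib_right)
        qed
        let ?p = "add_random_edges {..<n} E m1"
        let ?f = "\<lambda>E'. measure_pmf.prob (add_random_edges {..<n} E' m2) {E'. good_state K2 c2 b n E'}"
        let ?G = "{E'. good_state K1 c1 a1 n E'}"
        have "1 - \<eta> \<le> (1 - \<eta> / 2) * (1 - \<eta> / 2)" by (simp add: algebra_simps)
        also have "\<dots> \<le> (1 - \<eta> / 2) * measure_pmf.prob ?p ?G"
          using elim(1) m1 E True by (intro mult_left_mono) auto
        also have "\<dots> = measure_pmf.expectation ?p (\<lambda>E'. (1 - \<eta> / 2) * indicator ?G E')" by simp
        also have "\<dots> \<le> measure_pmf.expectation ?p ?f"
        proof (rule integral_mono)
          show "integrable ?p ?f" by (rule measure_pmf.integrable_const_bound[where B = 1]) auto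
          show "integrable ?p (\<lambda>E'. (1 - \<eta> / 2) * indicator ?G E')"
            by (rule measure_pmf.integrable_const_bound[where B = "\<bar>1 - \<eta> / 2\<bar>"]) (auto simp: indicator_def)
          show "(1 - \<eta> / 2) * indicator ?G E' \<le> ?f E'" for E'
            using elim(2) m2 by (auto simp: indicator_def)
        qed
        also have "\<dots> = measure_pmf.prob (add_random_edges {..<n} E m) {E'. good_state K2 c2 b n E'}"
          by (simp add: mm add_random_edges_add measure_pmf_prob_bind)
        finally show "measure_pmf.prob (add_random_edges {..<n} E m) {E'. good_state K2 c2 b n E'} \<ge> 1 - \<eta>" .
      qed
    qed
  qed
qed

text \<open>\<open>good_step\<close> covers every tail, so the tail constants may worsen from round
  to round; only the susceptibility bounds have to match.\<close>

lemma good_step_trans: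
  assumes "good_step x \<mu>1 x'" "good_step x' \<mu>2 y" "\<mu>1 \<ge> 0" "\<mu>2 \<ge> 0"
  shows "good_step x (\<mu>1 + \<mu>2) y"
  unfolding good_step_def
proof (intro allI impI)
  fix K c :: real assume "K > 0" "c > 0"
  then obtain K1 c1 where 1: "K1 > 0" "c1 > 0" "step_bound \<mu>1 K c (1 / x) K1 c1 (1 / x')"
    using assms(1) unfolding good_step_def by blast
  then obtain K2 c2 where 2: "K2 > 0" "c2 > 0" "step_bound \<mu>2 K1 c1 (1 / x') K2 c2 (1 / y)"
    using assms(2) unfolding good_step_def by blast
  show "\<exists>K'>0. \<exists>c'>0. step_bound (\<mu>1 + \<mu>2) K c (1 / x) K' c' (1 / y)"
    using step_bound_trans[OF 1(3) 2(3) assms(3,4)] 2(1,2) by blast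
qed

lemma step_bound_mono:
  assumes "step_bound \<mu>' K c a K' c' b" "\<mu> \<le> \<mu>'"
  shows "step_bound \<mu> K c a K' c' b"
  unfolding step_bound_def
proof (intro allI impI)
  fix \<eta> :: real assume "\<eta> > 0"
  have le: "real m \<le> \<mu>' * real n + 1" if "real m \<le> \<mu> * real n + 1" for m n
    using that mult_right_mono[OF assms(2), of "real n"] by simp
  from assms(1)[unfolded step_bound_def, rule_format, OF \<open>\<eta> > 0\<close>]
  show "\<forall>\<^sub>F n in sequentially. \<forall>m E. real m \<le> \<mu> * real n + 1 \<longrightarrow> good_state K c a n E \<longrightarrow>
      measure_pmf.prob (add_random_edges {..<n} E m) {E'. good_state K' c' b n E'} \<ge> 1 - \<eta>"
    by eventually_elim (use le in blast)
qed

text \<open>Equal rounds, their number independent of \<open>n\<close>, share the slack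
  \<open>x - y - 2 * \<mu>\<close> evenly. Every round starts from a reciprocal of at least
  \<open>y\<close>, so one bound on its length serves all rounds.\<close>

lemma good_step_pos:
  assumes "y > 0" "\<mu> > 0" "y + 2 * \<mu> < x"
  shows "good_step x \<mu> y"
proof -
  \<comment> \<open>The constant 80 turns into \<open>2 * \<nu> \<le> y / 40\<close>, the shortness
    condition of \<open>good_step_small\<close>.\<close>
  obtain N0 :: nat where N0: "80 * \<mu> / y \<le> real N0" using real_arch_simple by blast
  define N where "N = Suc N0"
  define d where "d = (x - y) / real N"
  define \<nu> where "\<nu> = \<mu> / real N"
  have N: "real N > 0" "80 * \<mu> / y \<le> real N" using N0 by (simp_all add: N_def)
  have \<nu>: "\<nu> > 0" "2 * \<nu> < d" using N assms by (simp_all add: \<nu>_def d_def divide_strict_right_mono)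
  have "80 * \<mu> \<le> real N * y" using N assms by (simp add: pos_divide_le_eq)
  then have \<nu>y: "2 * \<nu> \<le> y / 40" using N by (simp add: \<nu>_def field_simps)
  have Nd: "real N * d = x - y" using N by (simp add: d_def)
  have d: "d > 0" using \<nu> by linarith
  have step: "good_step (x - real i * d) \<nu> (x - real (Suc i) * d)" if "i < N" for i
  proof (rule good_step_small)
    have "real (Suc i) * d \<le> real N * d" using that d by (intro mult_right_mono) auto
    then show "x - real (Suc i) * d > 0" using Nd assms by linarith
    have "real i * d \<le> x - y" unfolding Nd[symmetric] using that d by (intro mult_right_mono) auto
    then have "y / 40 \<le> (x - real i * d) / 40" by (intro divide_right_mono) auto
    with \<nu>y show "2 * \<nu> \<le> (x - real i * d) / 40" by (rule order_trans)
    show "x - real (Suc i) * d + 2 * \<nu> < x - real i * d" using \<nu> by (simp add: algebra_simps)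
  qed (rule \<nu>(1))
  have "good_step x (real (Suc i) * \<nu>) (x - real (Suc i) * d)" if "i < N" for i
    using that
  proof (induction i)
    case 0
    then show ?case using step[of 0] by simp
  next
    case (Suc i)
    then have "good_step x (real (Suc i) * \<nu> + \<nu>) (x - real (Suc (Suc i)) * d)"
      using step[of "Suc i"] \<nu> by (intro good_step_trans) auto
    then show ?case by (simp add: algebra_simps)
  qed
  from this[of N0] show ?thesis using Nd N by (simp add: N_def \<nu>_def)
qed

text \<open>Covers \<open>\<mu> = 0\<close>, which arises for \<open>\<gamma> = 1\<close>:
  \<open>\<mu>\<close> is raised to its midpoint with \<open>(x - y) / 2\<close>, and a bound for
  more edges serves for fewer.\<close>

lemma good_step_all:
  assumes "y > 0" "\<mu> \<ge> 0" "y + 2 * \<mu> < x"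
  shows "good_step x \<mu> y"
proof -
  define \<mu>' where "\<mu>' = \<mu> / 2 + (x - y) / 4"
  have \<mu>': "\<mu>' > 0" "y + 2 * \<mu>' < x" "\<mu> \<le> \<mu>'"
    using assms by (simp_all add: \<mu>'_def field_simps)
  show ?thesis
    using good_step_pos[OF assms(1) \<mu>'(1,2)] step_bound_mono[OF _ \<mu>'(3)]
    unfolding good_step_def by meson
qed

section \<open>Diagonal argument and the final statement\<close>

lemma diagonal_sequence:
  fixes P :: "real \<Rightarrow> nat \<Rightarrow> bool"
  assumes "\<And>e. e > 0 \<Longrightarrow> \<forall>\<^sub>F n in sequentially. P e n"
  shows "\<exists>\<epsilon>. \<epsilon> \<longlonglongrightarrow> 0 \<and> (\<forall>\<^sub>F n in sequentially. P (\<epsilon> n) n)"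
proof -
  have "\<exists>N. \<forall>n\<ge>N. P (1 / real (Suc j)) n" for j
    using assms[of "1 / real (Suc j)"] by (simp add: eventually_sequentially)
  then obtain N where N: "\<And>j n. n \<ge> N j \<Longrightarrow> P (1 / real (Suc j)) n" by metis
  \<comment> \<open>The best precision already valid at \<open>n\<close>; the condition
    \<open>j \<le> n\<close> makes the maximum exist. For \<open>n < N 0\<close> the set may be
    empty, so the value is used only from \<open>N 0\<close> on.\<close>
  define k where "k = (\<lambda>n. Max {j. j \<le> n \<and> N j \<le> n})"
  have fin: "finite {j. j \<le> n \<and> N j \<le> n}" for n by simp
  have k: "P (1 / real (Suc (k n))) n" if "n \<ge> N 0" for n
    using Max_in[OF fin[of n]] that N[of "k n" n] by (auto simp: k_def)
  have "\<forall>\<^sub>F n in sequentially. k n \<ge> J" for J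
    using eventually_ge_at_top[of "max J (N J)"]
    by eventually_elim (auto simp: k_def intro!: Max_ge)
  then have "filterlim k at_top sequentially" by (simp add: filterlim_at_top)
  then have "(\<lambda>n. 1 / real (Suc (k n))) \<longlonglongrightarrow> 0"
    using filterlim_compose[OF LIMSEQ_Suc[OF lim_1_over_n]] by fast
  moreover have "\<forall>\<^sub>F n in sequentially. P (1 / real (Suc (k n))) n"
    using eventually_ge_at_top[of "N 0"] by eventually_elim (rule k)
  ultimately show ?thesis by blast
qed

text \<open>The rounds that give the bound \<open>L / \<gamma> + e\<close> depend on
  \<open>e\<close>, but \<open>K'\<close> and \<open>c'\<close> must not. So the tail is taken from
  \<open>e = 1\<close> once and for all, the susceptibility from the given \<open>e\<close>, and a
  union bound joins the two events for the same random graph.\<close>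

lemma good_state_with_high_probability:
  fixes L K c \<gamma> :: real and M :: "nat \<Rightarrow> nat"
  assumes "L > 0" and "K > 0" and "c > 0" and "\<gamma> > 0" and "\<gamma> \<le> 1"
    and "\<And>n. real (M n) \<le> (1 - \<gamma>) / (2 * L) * real n + 1"
  shows "\<exists>K' c'. K' > 0 \<and> c' > 0 \<and> (\<exists>\<epsilon>. \<epsilon> \<longlonglongrightarrow> 0 \<and> (\<forall>\<^sub>F n in sequentially. \<forall>E. good_state K c L n E \<longrightarrow>
    measure_pmf.prob (add_random_edges {..<n} E (M n)) {E'. good_state K' c' (L / \<gamma> + \<epsilon> n) n E'} \<ge> 1 - \<epsilon> n))"
proof -
  define x where "x = 1 / L"
  define \<mu> where "\<mu> = (1 - \<gamma>) / (2 * L)"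
  define g where "g = \<gamma> / L"
  have g: "g > 0" "x - 2 * \<mu> = g" "1 / g = L / \<gamma>"
    using assms by (simp_all add: g_def x_def \<mu>_def field_simps)
  have \<mu>: "\<mu> \<ge> 0" using assms by (simp add: \<mu>_def)
  have M: "real (M n) \<le> \<mu> * real n + 1" for n using assms(6) by (simp add: \<mu>_def)
  have step: "\<exists>K'>0. \<exists>c'>0. step_bound \<mu> K c L K' c' (L / \<gamma> + e)" if e: "e > 0" for e
  proof -
    \<comment> \<open>Chosen slightly below \<open>g\<close>, because \<open>good_step_all\<close>
      needs \<open>y + 2 * \<mu> < x\<close> strictly.\<close>
    define y where "y = 1 / (1 / g + e)"
    have "1 / g + e > 0" using g(1) e by (simp add: add_pos_pos)
    moreover have "g * (1 / g + e) > 1" using g(1) e by (simp add: distrib_left)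
    ultimately have y: "y > 0" "y < g" "1 / y = L / \<gamma> + e"
      using g(3) by (simp_all add: y_def pos_divide_less_eq)
    have "good_step x \<mu> y" using y g \<mu> by (intro good_step_all) auto
    then show ?thesis using assms(2,3) y(3) by (simp add: good_step_def x_def)
  qed
  obtain K' c' where K': "K' > 0" "c' > 0" and tail: "step_bound \<mu> K c L K' c' (L / \<gamma> + 1)"
    using step[OF zero_less_one] by blast
  define P where "P = (\<lambda>e n. \<forall>E. good_state K c L n E \<longrightarrow>
      measure_pmf.prob (add_random_edges {..<n} E (M n)) {E'. good_state K' c' (L / \<gamma> + e) n E'} \<ge> 1 - e)"
  have "\<forall>\<^sub>F n in sequentially. P e n" if e: "e > 0" for e
  proof -
    from step[OF e] obtain K2 c2 where s: "step_bound \<mu> K c L K2 c2 (L / \<gamma> + e)" by blast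
    from tail[unfolded step_bound_def, rule_format, OF half_gt_zero[OF e]]
      s[unfolded step_bound_def, rule_format, OF half_gt_zero[OF e]]
    show ?thesis
    proof eventually_elim
      case (elim n)
      show ?case unfolding P_def
      proof (intro allI impI)
        fix E assume E: "good_state K c L n E"
        let ?p = "add_random_edges {..<n} E (M n)"
        let ?A = "{E'. good_state K' c' (L / \<gamma> + 1) n E'}"
        let ?B = "{E'. good_state K2 c2 (L / \<gamma> + e) n E'}"
        have "measure_pmf.prob ?p ?A \<ge> 1 - e / 2" "measure_pmf.prob ?p ?B \<ge> 1 - e / 2"
          using elim M[of n] E by blast+
        then have AB: "measure_pmf.prob ?p (- ?A) \<le> e / 2" "measure_pmf.prob ?p (- ?B) \<le> e / 2"
          using measure_pmf.prob_compl[of ?A ?p] measure_pmf.prob_compl[of ?B ?p]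
          by (simp_all add: Compl_eq_Diff_UNIV)
        have "measure_pmf.prob ?p (- ?A \<union> - ?B) \<le> measure_pmf.prob ?p (- ?A) + measure_pmf.prob ?p (- ?B)"
          by (rule measure_Un_le) auto
        also have "\<dots> \<le> e" using AB by linarith
        finally show "measure_pmf.prob ?p {E'. good_state K' c' (L / \<gamma> + e) n E'} \<ge> 1 - e"
          by (rule pmf_prob_ge_if_complement) (auto simp: good_state_def)
      qed
    qed
  qed
  from diagonal_sequence[of P, OF this] obtain \<epsilon> where \<epsilon>: "\<epsilon> \<longlonglongrightarrow> 0" "\<forall>\<^sub>F n in sequentially. P (\<epsilon> n) n" by auto
  show ?thesis using K' \<epsilon> unfolding P_def by blast
qed

text \<open>High probability is expressed by sequences \<open>\<epsilon>\<close> and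
  \<open>p\<close> fixed before \<open>n\<close> and \<open>E\<close>, hence uniform over the
  initial graphs. \<open>\<gamma> \<le> 1\<close> makes the number of edges to be added
  nonnegative.\<close>

theorem theorem2p6:
  fixes L K c \<gamma> :: real
  assumes "L > 0" and "K > 0" and "c > 0" and "\<gamma> > 0" and "\<gamma> \<le> 1"
  shows "\<exists>K' c'. K' > 0 \<and> c' > 0 \<and>
    (\<exists>\<epsilon> p :: nat \<Rightarrow> real. \<epsilon> \<longlonglongrightarrow> 0 \<and> p \<longlonglongrightarrow> 1 \<and>
      (\<forall>(n::nat) (E :: nat set set).
         simple_graph {..<n} E \<longrightarrow> component_tail K c {..<n} E \<longrightarrow>
         susceptibility {..<n} E \<le> L \<longrightarrow>
         measure_pmf.prob (add_random_edges {..<n} E (nat \<lfloor>(1 - \<gamma>) * (real n / (2 * L))\<rfloor>))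
           {E'. component_tail K' c' {..<n} E' \<and> susceptibility {..<n} E' \<le> L / \<gamma> + \<epsilon> n}
         \<ge> p n))"
proof -
  define M where "M = (\<lambda>n. nat \<lfloor>(1 - \<gamma>) * (real n / (2 * L))\<rfloor>)"
  have "real (M n) \<le> (1 - \<gamma>) / (2 * L) * real n + 1" for n
  proof -
    have "real (M n) \<le> (1 - \<gamma>) * (real n / (2 * L))"
      using assms unfolding M_def by (intro of_nat_floor mult_nonneg_nonneg divide_nonneg_nonneg) auto
    then show ?thesis by simp
  qed
  from good_state_with_high_probability[OF assms this] obtain K' c' \<epsilon> where K': "K' > 0" "c' > 0"
    and \<epsilon>: "\<epsilon> \<longlonglongrightarrow> 0" "\<forall>\<^sub>F n in sequentially. \<forall>E. good_state K c L n E \<longrightarrow>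
      measure_pmf.prob (add_random_edges {..<n} E (M n)) {E'. good_state K' c' (L / \<gamma> + \<epsilon> n) n E'} \<ge> 1 - \<epsilon> n"
    by blast
  define P where "P = (\<lambda>n. \<forall>E. good_state K c L n E \<longrightarrow>
    measure_pmf.prob (add_random_edges {..<n} E (M n)) {E'. good_state K' c' (L / \<gamma> + \<epsilon> n) n E'} \<ge> 1 - \<epsilon> n)"
  \<comment> \<open>The bound is known only for all large \<open>n\<close>; the value 0 makes the
    claim trivial for the others and leaves the limit unchanged.\<close>
  define p where "p = (\<lambda>n. if P n then 1 - \<epsilon> n else 0)"
  have "(\<lambda>n. 1 - \<epsilon> n) \<longlonglongrightarrow> 1" using tendsto_diff[OF tendsto_const \<epsilon>(1), of 1] by simp
  moreover have "\<forall>\<^sub>F n in sequentially. p n = 1 - \<epsilon> n" using \<epsilon>(2) by eventually_elim (simp add: p_def P_def)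
  ultimately have p: "p \<longlonglongrightarrow> 1" by (simp add: filterlim_cong[OF refl refl])
  show ?thesis
  proof (rule exI[of _ K'], rule exI[of _ c'], intro conjI K', rule exI[of _ \<epsilon>], rule exI[of _ p],
      intro conjI \<epsilon>(1) p allI impI)
    fix n and E :: "nat set set"
    assume "component_tail K c {..<n} E" "susceptibility {..<n} E \<le> L"
    then show "p n \<le> measure_pmf.prob
           (add_random_edges {..<n} E (nat \<lfloor>(1 - \<gamma>) * (real n / (2 * L))\<rfloor>))
           {E'. component_tail K' c' {..<n} E' \<and> susceptibility {..<n} E' \<le> L / \<gamma> + \<epsilon> n}"
      by (auto simp: p_def P_def good_state_def M_def)
  qed
qed

end
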